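(* Let $p>2$ be a prime, $q=p^h$ with $q>p$, and $m\geq 2$. Suppose $\mathbf{s}\in \mathcal{C}_{\mathrm{AG}}(m,q)^\perp$ has a coordinate equal to $1$. Then \[\sigma(\mathbf{s})\geq (p-1)q^{m-1}+pq^{m-2}.\]
   Context: Let $\mathrm{AG}(m,q)$ be the affine space of dimension $m$ over $\mathbb{F}_q$, with points $x_1,\dots,x_v$ ($v=q^m$). The $p$-ary code $\mathcal{C}_{\mathrm{AG}}(m,q)\subseteq \mathbb{F}_p^v$ is the $\mathbb{F}_p$-span of the incidence vectors (indexed by the points) of the lines of $\mathrm{AG}(m,q)$; its dual $\mathcal{C}_{\mathrm{AG}}(m,q)^\perp$ is the set of vectors of $\mathbb{F}_p^v$ orthogonal to every codeword under the standard inner product. Equivalently, $\mathbf{s}\in\mathcal{C}_{\mathrm{AG}}(m,q)^\perp$ iff for every line the sum of the coordinates of $\mathbf{s}$ at the points of the line is $0$ in $\mathbb{F}_p$. For $\mathbf{s}\in\mathbb{F}_p^v$, $\sigma(\mathbf{s})$ denotes the sum (as an ordinary integer) of its coordinates, each coordinate identified with its representative in $\{0,1,\dots,p-1\}$. *)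

theory Defs
  imports "HOL-Analysis.Analysis" "Berlekamp_Zassenhaus.Finite_Field"
begin

text \<open>
  The point set of \<open>AG(m,q)\<close> is the type \<open>'k ^ 'm\<close>, where \<open>'k\<close> is a finite field with
  \<open>CARD('k) = q\<close> and \<open>CARD('m) = m\<close>. The field \<open>\<F>\<^sub>p\<close> is \<open>'p mod_ring\<close> with \<open>CARD('p) = p\<close>,
  so that \<open>\<F>\<^sub>p\<^sup>v\<close>, with coordinates indexed by the points, is
  \<open>'p mod_ring ^ ('k ^ 'm)\<close>.
\<close>

definition affine_lines :: "('k::{field,finite} ^ 'm::finite) set set" where
  "affine_lines = {range (\<lambda>t. a + t *s d) | a d. d \<noteq> 0}"

definition incidence_vector :: "'n set \<Rightarrow> ('f::field) ^ 'n::finite" where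
  "incidence_vector L = (\<chi> x. if x \<in> L then 1 else 0)"

definition AG_code :: "(('p::prime_card) mod_ring ^ ('k::{field,finite} ^ 'm::finite)) set" where
  "AG_code = vec.span (incidence_vector ` affine_lines)"

definition dual_code :: "(('f::field) ^ 'n::finite) set \<Rightarrow> ('f ^ 'n) set" where
  "dual_code C = {s. \<forall>c\<in>C. (\<Sum>x\<in>UNIV. s $ x * c $ x) = 0}"

text \<open>\<open>to_int_mod_ring\<close> yields the representative in \<open>{0..<CARD('p)}\<close>.\<close>

definition coord_sum :: "('p::prime_card) mod_ring ^ 'n::finite \<Rightarrow> int" where
  "coord_sum s = (\<Sum>x\<in>UNIV. to_int_mod_ring (s $ x))"

lemma mem_dual_AG_code_iff:
  fixes s :: "('p::prime_card) mod_ring ^ ('k::{field,finite} ^ 'm::finite)"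
  shows "s \<in> dual_code AG_code \<longleftrightarrow> (\<forall>L\<in>affine_lines. (\<Sum>x\<in>L. s $ x) = 0)"
proof -
  have inc: "(\<Sum>x\<in>UNIV. s $ x * incidence_vector L $ x) = (\<Sum>x\<in>L. s $ x)" for L
    by (simp add: incidence_vector_def if_distrib sum.If_cases cong: if_cong)
  show ?thesis
  proof
    assume "s \<in> dual_code AG_code"
    then show "\<forall>L\<in>affine_lines. (\<Sum>x\<in>L. s $ x) = 0"
      by (auto simp: dual_code_def AG_code_def inc[symmetric] intro: vec.span_base)
  next
    assume *: "\<forall>L\<in>affine_lines. (\<Sum>x\<in>L. s $ x) = 0"
    have "(\<Sum>x\<in>UNIV. s $ x * c $ x) = 0" if "c \<in> vec.span (incidence_vector ` affine_lines)" for c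
      using that
    proof (induction rule: vec.span_induct_alt)
      case base
      show ?case by simp
    next
      case (step a b y)
      then obtain L where "L \<in> affine_lines" "b = incidence_vector L" by auto
      then have "(\<Sum>x\<in>UNIV. s $ x * b $ x) = 0" using * inc by simp
      moreover have "(\<Sum>x\<in>UNIV. s $ x * (a *s b + y) $ x) =
          a * (\<Sum>x\<in>UNIV. s $ x * b $ x) + (\<Sum>x\<in>UNIV. s $ x * y $ x)"
        by (simp add: algebra_simps sum.distrib sum_distrib_left)
      ultimately show ?case using step by simp
    qed
    then show "s \<in> dual_code AG_code" by (simp add: dual_code_def AG_code_def)
  qed
qed

end

theory Submission
  imports "HOL-Algebra.Algebraic_Closure_Type" Defs
begin

text \<open>
  Identify \<open>AG(m,q)\<close> with the field of order \<open>q ^ m\<close> through a linear embedding \<open>\<phi>\<close>, let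
  \<open>N = 1 + q + \<dots> + q ^ (m - 1)\<close> and let \<open>c x\<close> be the representative of \<open>s $ x\<close>. Consider
  \<open>F(X,T) = \<Prod>x. (1 - (\<phi> x + X) ^ (q - 1) * T) ^ c x\<close>, whose degree in \<open>T\<close> is at most
  \<open>\<sigma> = (\<Sum>x. c x)\<close>; let \<open>e k\<close> be the coefficient of \<open>T ^ k\<close>, a polynomial in \<open>X\<close>.

  A function \<open>x \<mapsto> \<phi> x ^ \<epsilon>\<close> is orthogonal to the dual code unless a cyclically weighted sum of
  the base \<open>p\<close> digits of \<open>\<epsilon>\<close> is large. Hence the power sums
  \<open>s i = (\<Sum>x. c x * (\<phi> x + X) ^ (i * (q - 1)))\<close> vanish identically in \<open>X\<close> unless \<open>i = \<rho> * N\<close> or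
  \<open>i > \<rho> * N + q ^ (m - 2)\<close>, where \<open>\<rho> = i mod p\<close>. By Newton's identities this gap forces
  \<open>e ((p - 1) * N + J) = e ((p - 1) * N) * e J\<close> for \<open>J = q ^ (m - 2)\<close>, and at a point of
  coordinate \<open>1\<close> the factor \<open>e ((p - 1) * N)\<close> takes the value \<open>1\<close>; so \<open>\<sigma> \<ge> (p - 1) * N\<close>.
  If \<open>\<sigma>\<close> were below the claimed bound, then \<open>e ((p - 1) * N + J) = 0\<close> for degree reasons, while
  the coefficient of \<open>X ^ ((q - 1) * J)\<close> in \<open>e J\<close> is up to sign \<open>\<sigma> choose J\<close>, which by Lucas' theorem is
  congruent to \<open>(p - 1) * (q + 1)\<close>, hence nonzero, modulo \<open>p\<close>.
  For \<open>m = 2\<close>, where \<open>J\<close> is not divisible by \<open>p\<close>, it suffices that \<open>p\<close> divides \<open>\<sigma>\<close>.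
\<close>

section \<open>Cyclically weighted digit sums\<close>

text \<open>
  The base \<open>p\<close> digit at position \<open>b\<close> has weight \<open>p ^ ((j + b) mod h)\<close>, so this is the base
  \<open>p ^ h\<close> digit sum of \<open>p ^ j * n\<close> when \<open>j < h\<close>.
\<close>

function digit_wt :: "nat \<Rightarrow> nat \<Rightarrow> nat \<Rightarrow> nat \<Rightarrow> nat" where
  "digit_wt p h j n =
    (if p < 2 \<or> n = 0 then 0 else (n mod p) * p ^ (j mod h) + digit_wt p h (Suc j) (n div p))"
  by auto
termination by (relation "Wellfounded.measure (\<lambda>(p, h, j, n). n)") auto

declare digit_wt.simps [simp del]

lemma digit_wt_0 [simp]: "digit_wt p h j 0 = 0"
  by (simp add: digit_wt.simps)

lemma digit_wt_rec:
  assumes "p \<ge> 2" "r < p"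
  shows "digit_wt p h j (p * n + r) = r * p ^ (j mod h) + digit_wt p h (Suc j) n"
proof (cases "p * n + r = 0")
  case True
  then show ?thesis using assms by auto
next
  case False
  then show ?thesis using assms by (subst digit_wt.simps) simp
qed

lemma digit_wt_div_mod:
  assumes "p \<ge> 2"
  shows "digit_wt p h j n = (n mod p) * p ^ (j mod h) + digit_wt p h (Suc j) (n div p)"
  using digit_wt_rec[OF assms, of "n mod p" h j "n div p"] assms by simp

lemma power_Suc_mod_le:
  fixes p h j :: nat
  assumes "p \<ge> 1"
  shows "p ^ (Suc j mod h) \<le> p * p ^ (j mod h)"
proof -
  have "Suc j mod h \<le> Suc (j mod h)" by (simp add: mod_Suc)
  then have "p ^ (Suc j mod h) \<le> p ^ Suc (j mod h)"
    using assms by (intro power_increasing) auto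
  then show ?thesis by simp
qed

text \<open>If the lowest digit is \<open>p - 1\<close>, the carry trades its contribution
  \<open>(p - 1) * p ^ (j mod h)\<close> for an increment at the next position, whose weight is at
  most \<open>p * p ^ (j mod h)\<close>. Otherwise only the lowest digit grows.\<close>

lemma digit_wt_Suc_le:
  assumes "p \<ge> 2"
  shows "digit_wt p h j (Suc n) \<le> digit_wt p h j n + p ^ (j mod h)"
proof (induction n arbitrary: j rule: less_induct)
  case (less n)
  define k r where "k = n div p" and "r = n mod p"
  have n: "n = p * k + r" and r: "r < p" using assms by (auto simp: k_def r_def)
  show ?case
  proof (cases "Suc r < p")
    case True
    then show ?thesis
      using digit_wt_rec[OF assms True, of h j k] digit_wt_rec[OF assms r, of h j k]
      by (simp add: n)
  next
    case False
    then have r': "p = Suc r" using r by simp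
    have "k < n"
      using assms r' n by (cases k) auto
    from less.IH[OF this, of "Suc j"]
    have "digit_wt p h (Suc j) (Suc k) \<le> digit_wt p h (Suc j) k + p ^ (Suc j mod h)" .
    also have "p ^ (Suc j mod h) \<le> p * p ^ (j mod h)"
      by (rule power_Suc_mod_le) (use assms in simp)
    finally have *: "digit_wt p h (Suc j) (Suc k) \<le> digit_wt p h (Suc j) k + p * p ^ (j mod h)" by simp
    have "Suc n = p * Suc k + 0" by (simp add: n r')
    then have "digit_wt p h j (Suc n) = digit_wt p h (Suc j) (Suc k)"
      using digit_wt_rec[OF assms, of 0 h j "Suc k"] assms by simp
    moreover have "digit_wt p h j n = r * p ^ (j mod h) + digit_wt p h (Suc j) k"
      unfolding n using assms r by (rule digit_wt_rec)
    moreover have "p * p ^ (j mod h) = r * p ^ (j mod h) + p ^ (j mod h)" by (subst r') simp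
    ultimately show ?thesis using * by simp
  qed
qed

lemma digit_wt_eq_sum:
  assumes "p \<ge> 2" "n < p ^ M"
  shows "digit_wt p h j n = (\<Sum>c<M. (n div p ^ c mod p) * p ^ ((j + c) mod h))"
  using assms(2)
proof (induction M arbitrary: j n)
  case 0
  then show ?case by simp
next
  case (Suc M)
  have k: "n div p < p ^ M"
    using Suc.prems by (simp add: less_mult_imp_div_less mult.commute)
  show ?case
    using Suc.IH[OF k, of "Suc j"]
    by (subst digit_wt_div_mod[OF assms(1)], subst sum.lessThan_Suc_shift) (simp add: div_mult2_eq)
qed

text \<open>All \<open>m * h\<close> digits equal \<open>p - 1\<close>, and each block of
  \<open>h\<close> positions meets every weight \<open>p ^ 0, ..., p ^ (h - 1)\<close> once,
  contributing \<open>p ^ h - 1\<close>.\<close>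

lemma digit_wt_full:
  assumes "p \<ge> 2" "h \<ge> 1"
  shows "digit_wt p h j (p ^ (m * h) - 1) = m * (p ^ h - 1)"
proof -
  have dig: "(p ^ M - 1) div p ^ c mod p = p - 1" if "c < M" for M c
    using that
  proof (induction c arbitrary: M)
    case 0
    then obtain M' where M: "M = Suc M'" by (cases M) auto
    have "p ^ M - 1 = p * (p ^ M' - 1) + (p - 1)"
      using assms by (simp add: M algebra_simps diff_mult_distrib2)
    then have "(p ^ M - 1) mod p = (p - 1) mod p" by (metis mod_mult_self4)
    then show ?case using assms by simp
  next
    case (Suc c)
    then obtain M' where M: "M = Suc M'" by (cases M) auto
    have "p ^ M - 1 = p * (p ^ M' - 1) + (p - 1)"
      using assms by (simp add: M algebra_simps diff_mult_distrib2)
    also have "\<dots> div p = p ^ M' - 1" using assms by (subst div_mult_self4) auto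
    finally have "(p ^ M - 1) div p = p ^ M' - 1" .
    then show ?case using Suc M by (simp add: div_mult2_eq)
  qed
  have geo: "(\<Sum>b<h. (p - 1) * p ^ b) = p ^ h - 1"
    using assms power_diff_1_eq[of "int p" h]
    by (simp add: of_nat_diff sum_distrib_left flip: of_nat_eq_iff[where 'a = int])
  have shift: "(\<Sum>b<h. p ^ ((i + b) mod h)) = (\<Sum>b<h. p ^ b)" for i
  proof (rule sum.reindex_bij_betw)
    have "inj_on (\<lambda>b. (i + b) mod h) {..<h}"
    proof (rule inj_onI)
      fix x y assume *: "x \<in> {..<h}" "y \<in> {..<h}" "(i + x) mod h = (i + y) mod h"
      then have "[x = y] (mod h)" by (simp add: unique_euclidean_semiring_class.cong_def[symmetric] cong_add_lcancel_nat)
      then show "x = y" using * by (simp add: unique_euclidean_semiring_class.cong_def)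
    qed
    moreover have "(\<lambda>b. (i + b) mod h) ` {..<h} \<subseteq> {..<h}" using assms by auto
    ultimately show "bij_betw (\<lambda>b. (i + b) mod h) {..<h} {..<h}"
      by (simp add: bij_betw_def endo_inj_surj)
  qed
  have "digit_wt p h j (p ^ (m * h) - 1) = (\<Sum>c<m * h. (p - 1) * p ^ ((j + c) mod h))"
    using assms by (subst digit_wt_eq_sum[where M = "m * h"]) (auto intro!: sum.cong simp: dig[unfolded One_nat_def])
  also have "\<dots> = (\<Sum>a<m. \<Sum>c\<in>{a * h..<a * h + h}. (p - 1) * p ^ ((j + c) mod h))"
    by (rule sum.nat_group[symmetric])
  also have "\<dots> = (\<Sum>a<m. \<Sum>b<h. (p - 1) * p ^ ((j + a * h + b) mod h))"
  proof (rule sum.cong[OF refl])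
    fix a
    show "(\<Sum>c\<in>{a * h..<a * h + h}. (p - 1) * p ^ ((j + c) mod h))
        = (\<Sum>b<h. (p - 1) * p ^ ((j + a * h + b) mod h))"
      using sum.shift_bounds_nat_ivl[of "\<lambda>c. (p - 1) * p ^ ((j + c) mod h)" 0 "a * h" h]
      by (simp add: lessThan_atLeast0 add_ac)
  qed
  also have "\<dots> = (\<Sum>a<m. p ^ h - 1)"
    by (simp only: sum_distrib_left[symmetric] shift) (simp only: sum_distrib_left geo)
  finally show ?thesis by simp
qed

text \<open>Subtraction from \<open>p ^ M - 1\<close> involves no borrowing: every digit
  \<open>r\<close> turns into \<open>p - 1 - r\<close>.\<close>

lemma digit_wt_compl:
  assumes "p \<ge> 2" "n < p ^ M"
  shows "digit_wt p h j n + digit_wt p h j (p ^ M - 1 - n) = digit_wt p h j (p ^ M - 1)"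
  using assms(2)
proof (induction M arbitrary: j n)
  case 0
  then show ?case by simp
next
  case (Suc M)
  define k r where "k = n div p" and "r = n mod p"
  have n: "n = p * k + r" and r: "r < p" using assms by (auto simp: k_def r_def)
  have k: "k < p ^ M"
    unfolding k_def using Suc.prems by (simp add: less_mult_imp_div_less mult.commute)
  have full: "p ^ Suc M - 1 = p * (p ^ M - 1) + (p - 1)"
    using assms by (simp add: algebra_simps diff_mult_distrib2)
  define z where "z = p ^ M - 1 - k"
  have z: "p ^ M - 1 = k + z" using k by (simp add: z_def)
  have compl: "p ^ Suc M - 1 - n = p * (p ^ M - 1 - k) + (p - 1 - r)"
    unfolding full z using r by (simp add: n algebra_simps)
  have "(p - 1) * p ^ (j mod h) = r * p ^ (j mod h) + (p - 1 - r) * p ^ (j mod h)"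
    using r by (simp flip: add_mult_distrib)
  moreover have "digit_wt p h j (p ^ Suc M - 1 - n)
      = (p - 1 - r) * p ^ (j mod h) + digit_wt p h (Suc j) (p ^ M - 1 - k)"
    unfolding compl by (rule digit_wt_rec) (use assms in auto)
  moreover have "digit_wt p h j (p ^ Suc M - 1)
      = (p - 1) * p ^ (j mod h) + digit_wt p h (Suc j) (p ^ M - 1)"
    unfolding full by (rule digit_wt_rec) (use assms in auto)
  moreover have "digit_wt p h j n = r * p ^ (j mod h) + digit_wt p h (Suc j) k"
    unfolding n by (rule digit_wt_rec[OF assms(1) r])
  ultimately show ?case using Suc.IH[OF k, of "Suc j"] by simp
qed

text \<open>Modulo \<open>p ^ h - 1\<close> an exponent of \<open>p\<close> matters only modulo
  \<open>h\<close>, so the cyclic weights may be replaced by ordinary powers of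
  \<open>p\<close>.\<close>

lemma digit_wt_cong:
  assumes "p \<ge> 2" "h \<ge> 1"
  shows "[digit_wt p h j n = p ^ (j mod h) * n] (mod (p ^ h - 1))"
proof (induction n arbitrary: j rule: less_induct)
  case (less n)
  show ?case
  proof (cases "n = 0")
    case False
    define k r where "k = n div p" and "r = n mod p"
    have n: "n = p * k + r" and r: "r < p" using assms by (auto simp: k_def r_def)
    have "k < n" unfolding k_def using assms False by simp
    then have IH: "[digit_wt p h (Suc j) k = p ^ (Suc j mod h) * k] (mod (p ^ h - 1))"
      by (rule less.IH)
    have pw: "[p ^ (Suc j mod h) = p * p ^ (j mod h)] (mod (p ^ h - 1))"
    proof (cases "Suc (j mod h) = h")
      case True
      then have "Suc j mod h = 0" by (simp add: mod_Suc)
      moreover have "p * p ^ (j mod h) = p ^ h" using True by (metis power_Suc)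
      moreover have "p ^ h = 1 + (p ^ h - 1)" using assms by simp
      then have "[1 = p ^ h] (mod (p ^ h - 1))"
        by (metis cong_add_rcancel_0_nat unique_euclidean_semiring_class.cong_def mod_add_self2)
      ultimately show ?thesis by simp
    next
      case False
      then show ?thesis by (simp add: mod_Suc)
    qed
    have "digit_wt p h j n = r * p ^ (j mod h) + digit_wt p h (Suc j) k"
      unfolding n by (rule digit_wt_rec[OF assms(1) r])
    also have "[\<dots> = r * p ^ (j mod h) + p * p ^ (j mod h) * k] (mod (p ^ h - 1))"
      by (intro cong_add cong_refl cong_trans[OF IH] cong_mult pw)
    also have "r * p ^ (j mod h) + p * p ^ (j mod h) * k = p ^ (j mod h) * n"
      by (simp add: n algebra_simps)
    finally show ?thesis .
  qed simp
qed

lemma dvd_digit_wt: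
  assumes "p \<ge> 2" "h \<ge> 1" "(p ^ h - 1) dvd n"
  shows "(p ^ h - 1) dvd digit_wt p h j n"
  using digit_wt_cong[OF assms(1,2), of j n] assms(3) by (simp add: cong_dvd_iff)

section \<open>Sub-digits whose value is divisible by \<open>p ^ h - 1\<close>\<close>

text \<open>Think of \<open>l b\<close> as the carry into position \<open>b\<close>. If
  \<open>p * l (Suc b) = w b + l b\<close> and \<open>l h = l 0\<close>, telescoping gives the value
  \<open>(p ^ h - 1) * l 0\<close>. The hypothesis supplies positive carries with
  \<open>p * l (Suc b) \<le> n b + l b\<close>, and a minimal choice of them makes every
  \<open>w b\<close> nonnegative.\<close>

lemma exists_cyclic_carry_sequence:
  fixes n :: "nat \<Rightarrow> nat" and p h :: nat
  assumes p: "p \<ge> 2" and h: "h \<ge> 1"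
    and big: "\<And>j. (\<Sum>b<h. n b * p ^ ((j + b) mod h)) \<ge> p ^ h - 1"
  shows "\<exists>w L. (\<forall>b<h. w b \<le> n b) \<and> L > 0 \<and> (\<Sum>b<h. w b * p ^ b) = (p ^ h - 1) * L"
proof -
  define V where "V = (\<lambda>j. \<Sum>b<h. n b * p ^ ((j + b) mod h))"
  define q1 where "q1 = p ^ h - 1"
  have q1: "q1 > 0" unfolding q1_def using p h
    by (metis One_nat_def Suc_1 less_le_trans nat_less_le not_gr_zero one_less_power lessI zero_less_diff zero_less_one_class.zero_le_one)
  have q1': "p ^ h = Suc q1" unfolding q1_def using p by simp
  define good where "good = (\<lambda>l :: nat \<Rightarrow> nat. l h = l 0 \<and> (\<forall>b\<le>h. 1 \<le> l b) \<and> (\<forall>b<h. p * l (Suc b) \<le> n b + l b))"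
  \<comment> \<open>Multiplication by \<open>p\<close> moves every weight up one place. Only the
    term \<open>c = b\<close> has weight \<open>p ^ (h - 1)\<close>; it wraps around to weight
    \<open>1\<close> and leaves the excess \<open>q1 * n b\<close>, since
    \<open>p ^ h = 1 + q1\<close>.\<close>
  have Vstep: "p * V (h - Suc b) = V (h - b) + q1 * n b" if b: "b < h" for b
  proof -
    have t: "p * (n c * p ^ ((h - Suc b + c) mod h))
        = n c * p ^ ((h - b + c) mod h) + (if c = b then q1 * n b else 0)" if c: "c < h" for c
    proof (cases "c = b")
      case True
      have "(h - Suc b + b) mod h = h - 1" using b by simp
      moreover have "(h - b + b) mod h = 0" using b by simp
      moreover have "p * p ^ (h - 1) = Suc q1"
        using h q1' by (metis One_nat_def Suc_le_D diff_Suc_1 power_Suc)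
      moreover have "p * (n b * p ^ (h - 1)) = n b * (p * p ^ (h - 1))" by simp
      ultimately show ?thesis using True by simp
    next
      case False
      have s: "h - b + c = Suc (h - Suc b + c)" using b by simp
      have "Suc (h - Suc b + c) mod h \<noteq> 0"
      proof
        assume "Suc (h - Suc b + c) mod h = 0"
        then have "h dvd h - b + c" using s by (simp add: dvd_eq_mod_eq_0)
        then obtain t where t: "h - b + c = h * t" by blast
        have "h - b + c < h * 2" "0 < h - b + c" using b c by auto
        then have "t < 2" "0 < t" unfolding t by simp_all
        then have "t = 1" by simp
        then show False using t b c False by simp
      qed
      then have eq: "(h - b + c) mod h = Suc ((h - Suc b + c) mod h)"
        using s by (metis mod_Suc)
      show ?thesis unfolding eq using False by simp
    qed
    have "p * V (h - Suc b) = (\<Sum>c<h. p * (n c * p ^ ((h - Suc b + c) mod h)))"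
      by (simp add: V_def sum_distrib_left)
    also have "\<dots> = (\<Sum>c<h. n c * p ^ ((h - b + c) mod h) + (if c = b then q1 * n b else 0))"
      by (rule sum.cong) (use t in auto)
    also have "\<dots> = V (h - b) + q1 * n b"
      using b by (simp add: sum.distrib V_def)
    finally show ?thesis .
  qed
  \<comment> \<open>By \<open>Vstep\<close> the quotients \<open>V (h - b) / q1\<close> satisfy \<open>p * l (Suc b) = n b + l b\<close>; rounding down keeps \<open>\<le>\<close>.\<close>
  have "good (\<lambda>b. V (h - b) div q1)"
    unfolding good_def
  proof (intro conjI allI impI)
    have "V h = V 0" by (simp add: V_def)
    then show "V (h - h) div q1 = V (h - 0) div q1" by simp
    have "q1 \<le> V j" for j using big[of j] by (simp only: V_def q1_def)
    then show "1 \<le> V (h - b) div q1" for b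
      using q1 by (simp add: div_greater_zero_iff Suc_le_eq)
    show "p * (V (h - Suc b) div q1) \<le> n b + V (h - b) div q1" if "b < h" for b
    proof -
      have "p * (V (h - Suc b) div q1) \<le> (p * V (h - Suc b)) div q1"
        by (metis div_mult2_eq less_eq_div_iff_mult_less_eq mult.assoc mult.commute mult_le_mono2 q1 times_div_less_eq_dividend)
      also have "\<dots> = n b + V (h - b) div q1"
        using q1 by (simp add: Vstep[OF that])
      finally show ?thesis .
    qed
  qed
  \<comment> \<open>Rounding down may produce \<open>l b > p * l (Suc b)\<close>, where the
    difference \<open>w b\<close> would be truncated. A \<open>good\<close> sequence of least sum
    avoids this.\<close>
  then obtain l where l: "good l" and min: "\<And>l'. good l' \<Longrightarrow> (\<Sum>b<h. l b) \<le> (\<Sum>b<h. l' b)"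
    using ex_has_least_nat[of good _ "\<lambda>l. \<Sum>b<h. l b"] by blast
  have lower: "l b \<le> p * l (Suc b)" if b: "b < h" for b
  proof (rule ccontr)
    assume less: "\<not> ?thesis"
    \<comment> \<open>Lowering \<open>l b\<close> by one keeps the sequence \<open>good\<close>:
      index \<open>h\<close> follows index \<open>0\<close>, the inequality at \<open>b\<close> has
      slack, and the other inequalities only relax.\<close>
    define l' where "l' = (\<lambda>c. if c = b \<or> (b = 0 \<and> c = h) then l c - 1 else l c)"
    have l1: "1 \<le> l c" if "c \<le> h" for c using l that by (auto simp: good_def)
    have l2: "2 \<le> l b" using less l1[of "Suc b"] b p
      by (metis Suc_leI le_trans mult_le_mono not_less mult_1_right nat_le_linear less_imp_le_nat)
    have lh: "l h = l 0" using l by (simp add: good_def)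
    have "good l'"
      unfolding good_def
    proof (intro conjI allI impI)
      show "l' h = l' 0" using b lh by (auto simp: l'_def)
      show "1 \<le> l' c" if "c \<le> h" for c using l1[OF that] l2 lh by (auto simp: l'_def)
      show "p * l' (Suc c) \<le> n c + l' c" if c: "c < h" for c
      proof (cases "c = b")
        case True
        have "l' (Suc b) \<le> l (Suc b)" by (simp add: l'_def)
        then have "p * l' (Suc b) \<le> p * l (Suc b)" by simp
        also have "\<dots> \<le> l b - 1" using less by simp
        also have "\<dots> = l' b" by (simp add: l'_def)
        finally show ?thesis using True by simp
      next
        case False
        have "p * l' (Suc c) \<le> p * l (Suc c)" by (simp add: l'_def)
        also have "\<dots> \<le> n c + l c" using l c by (auto simp: good_def)
        also have "l c = l' c" using False c by (auto simp: l'_def)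
        finally show ?thesis .
      qed
    qed
    then have "(\<Sum>c<h. l c) \<le> (\<Sum>c<h. l' c)" by (rule min)
    moreover have "(\<Sum>c<h. l' c) < (\<Sum>c<h. l c)"
    proof (rule sum_strict_mono_ex1)
      show "\<exists>c\<in>{..<h}. l' c < l c" using b l2 by (intro bexI[of _ b]) (auto simp: l'_def)
    qed (auto simp: l'_def)
    ultimately show False by simp
  qed
  define w where "w = (\<lambda>b. p * l (Suc b) - l b)"
  have tele: "(\<Sum>b<k. w b * p ^ b) + l 0 = p ^ k * l k" if "k \<le> h" for k
    using that
  proof (induction k)
    case (Suc k)
    have "w k + l k = p * l (Suc k)" using lower[of k] Suc.prems by (simp add: w_def)
    then have "(w k + l k) * p ^ k = p * l (Suc k) * p ^ k" by simp
    then show ?case using Suc by (simp add: algebra_simps)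
  qed simp
  have "(\<Sum>b<h. w b * p ^ b) = q1 * l 0"
    using tele[of h] l q1' by (simp add: good_def)
  moreover have "w b \<le> n b" if "b < h" for b
    using l that by (auto simp: good_def w_def)
  moreover have "l 0 > 0" using l by (auto simp: good_def Suc_le_eq)
  ultimately show ?thesis unfolding q1_def by blast
qed

lemma exists_le_with_sum:
  fixes f :: "nat \<Rightarrow> nat"
  assumes "w \<le> (\<Sum>a<m. f a)"
  shows "\<exists>g. (\<forall>a<m. g a \<le> f a) \<and> (\<Sum>a<m. g a) = w"
  using assms
proof (induction m arbitrary: w)
  case (Suc m)
  have "w - min w (f m) \<le> (\<Sum>a<m. f a)" using Suc.prems by simp
  from Suc.IH[OF this] obtain g where g: "\<forall>a<m. g a \<le> f a" "(\<Sum>a<m. g a) = w - min w (f m)"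
    by blast
  then show ?case
    by (intro exI[of _ "g(m := min w (f m))"]) (auto simp: less_Suc_eq)
qed simp

lemma sum_blocks:
  fixes F :: "nat \<Rightarrow> 'a::comm_monoid_add"
  shows "(\<Sum>c<m * h. F c) = (\<Sum>b<h. \<Sum>a<m. F (a * h + b))"
proof -
  have "(\<Sum>c<m * h. F c) = (\<Sum>a<m. \<Sum>c\<in>{a * h..<a * h + h}. F c)"
    by (rule sum.nat_group[symmetric])
  also have "\<dots> = (\<Sum>a<m. \<Sum>b<h. F (a * h + b))"
  proof (rule sum.cong[OF refl])
    fix a
    show "(\<Sum>c\<in>{a * h..<a * h + h}. F c) = (\<Sum>b<h. F (a * h + b))"
      using sum.shift_bounds_nat_ivl[of F 0 "a * h" h] by (simp add: lessThan_atLeast0 add_ac)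
  qed
  also have "\<dots> = (\<Sum>b<h. \<Sum>a<m. F (a * h + b))" by (rule sum.swap)
  finally show ?thesis .
qed

text \<open>Positions congruent modulo \<open>h\<close> share a weight. So
  \<open>exists_cyclic_carry_sequence\<close> is applied to the digit totals \<open>n b\<close> of
  the residue classes, and each \<open>w b\<close> is then distributed over the \<open>m\<close>
  digits of its class; modulo \<open>p ^ h - 1\<close> the place within the class does not change
  the value.\<close>

lemma exists_subdigits_dvd:
  fixes p h m u :: nat
  assumes p: "p \<ge> 2" and h: "h \<ge> 1" and u: "u < p ^ (m * h)"
    and big: "\<And>j. digit_wt p h j u \<ge> p ^ h - 1"
  shows "\<exists>d. (\<forall>c<m * h. d c \<le> u div p ^ c mod p) \<and> (\<Sum>c<m * h. d c * p ^ c) > 0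
    \<and> (p ^ h - 1) dvd (\<Sum>c<m * h. d c * p ^ c)"
proof -
  define dig where "dig = (\<lambda>c. u div p ^ c mod p)"
  define n where "n = (\<lambda>b. \<Sum>a<m. dig (a * h + b))"
  have "(\<Sum>b<h. n b * p ^ ((j + b) mod h)) \<ge> p ^ h - 1" for j
  proof -
    have "digit_wt p h j u = (\<Sum>b<h. \<Sum>a<m. dig (a * h + b) * p ^ ((j + (a * h + b)) mod h))"
      using digit_wt_eq_sum[OF p u, of h j] by (simp add: sum_blocks dig_def)
    also have "\<dots> = (\<Sum>b<h. n b * p ^ ((j + b) mod h))"
    proof (intro sum.cong refl)
      fix b
      have "(j + (a * h + b)) mod h = (j + b) mod h" for a
        by (metis add.assoc add.commute mod_mult_self1)
      then show "(\<Sum>a<m. dig (a * h + b) * p ^ ((j + (a * h + b)) mod h)) = n b * p ^ ((j + b) mod h)"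
        by (simp add: n_def sum_distrib_right)
    qed
    finally show ?thesis using big[of j] by simp
  qed
  from exists_cyclic_carry_sequence[OF p h this]
  obtain w L where w: "\<And>b. b < h \<Longrightarrow> w b \<le> n b" and L: "L > 0"
    and sw: "(\<Sum>b<h. w b * p ^ b) = (p ^ h - 1) * L" by blast
  have "\<exists>g. (\<forall>a<m. g a \<le> dig (a * h + b)) \<and> (\<Sum>a<m. g a) = w b" if "b < h" for b
    using exists_le_with_sum[of "w b" "\<lambda>a. dig (a * h + b)" m] w[OF that] by (simp add: n_def)
  then obtain g where g: "\<And>a b. b < h \<Longrightarrow> a < m \<Longrightarrow> g b a \<le> dig (a * h + b)"
    and gs: "\<And>b. b < h \<Longrightarrow> (\<Sum>a<m. g b a) = w b" by metis
  define d where "d = (\<lambda>c. g (c mod h) (c div h))"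
  have sd: "(\<Sum>c<m * h. d c * p ^ c) = (\<Sum>b<h. \<Sum>a<m. g b a * p ^ (a * h + b))"
    by (simp add: sum_blocks d_def)
  have "[(\<Sum>c<m * h. d c * p ^ c) = (\<Sum>b<h. \<Sum>a<m. g b a * p ^ b)] (mod (p ^ h - 1))"
    unfolding sd
  proof (intro cong_sum)
    fix a b
    have "p ^ h = 1 + (p ^ h - 1)" using p by simp
    then have "[p ^ h = 1] (mod (p ^ h - 1))"
      by (metis unique_euclidean_semiring_class.cong_def mod_add_self2)
    then have "[(p ^ h) ^ a = 1 ^ a] (mod (p ^ h - 1))" by (rule cong_pow)
    then have "[g b a * (p ^ h) ^ a * p ^ b = g b a * 1 * p ^ b] (mod (p ^ h - 1))"
      by (intro cong_mult cong_refl) simp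
    then show "[g b a * p ^ (a * h + b) = g b a * p ^ b] (mod (p ^ h - 1))"
      by (simp add: power_add mult.commute[of a h] power_mult mult.assoc)
  qed
  also have "(\<Sum>b<h. \<Sum>a<m. g b a * p ^ b) = (p ^ h - 1) * L"
    unfolding sw[symmetric] by (intro sum.cong refl) (simp add: gs flip: sum_distrib_right)
  finally have dvd: "(p ^ h - 1) dvd (\<Sum>c<m * h. d c * p ^ c)"
    by (simp add: cong_dvd_iff)
  have "(\<Sum>b<h. w b * p ^ b) \<le> (\<Sum>c<m * h. d c * p ^ c)"
    unfolding sd
  proof (intro sum_mono)
    fix b assume "b \<in> {..<h}"
    then have "w b * p ^ b = (\<Sum>a<m. g b a * p ^ b)" by (simp add: gs flip: sum_distrib_right)
    also have "\<dots> \<le> (\<Sum>a<m. g b a * p ^ (a * h + b))"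
      using p by (intro sum_mono mult_le_mono2 power_increasing) auto
    finally show "w b * p ^ b \<le> (\<Sum>a<m. g b a * p ^ (a * h + b))" .
  qed
  moreover have "(\<Sum>b<h. w b * p ^ b) > 0"
    unfolding sw using L p h one_less_power[of p h] by simp
  ultimately have pos: "(\<Sum>c<m * h. d c * p ^ c) > 0" by simp
  have "d c \<le> dig c" if "c < m * h" for c
  proof -
    have "c mod h < h" using h by simp
    moreover have "c div h < m" using that by (simp add: less_mult_imp_div_less)
    ultimately show ?thesis using g[of "c mod h" "c div h"] by (simp add: d_def)
  qed
  then show ?thesis using pos dvd unfolding dig_def by blast
qed

lemma sum_digits:
  fixes p u M :: nat
  assumes "p \<ge> 1" "u < p ^ M"
  shows "(\<Sum>c<M. (u div p ^ c mod p) * p ^ c) = u"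
  using assms(2)
proof (induction M arbitrary: u)
  case (Suc M)
  have "u div p < p ^ M"
    using Suc.prems by (simp add: less_mult_imp_div_less mult.commute)
  from Suc.IH[OF this] have IH: "(\<Sum>c<M. (u div p div p ^ c mod p) * p ^ c) = u div p" .
  have "(\<Sum>c<Suc M. (u div p ^ c mod p) * p ^ c) = u mod p + p * (\<Sum>c<M. (u div p div p ^ c mod p) * p ^ c)"
    by (simp add: sum.lessThan_Suc_shift sum_distrib_left div_mult2_eq mult_ac del: sum.lessThan_Suc)
  then show ?case unfolding IH by simp
qed simp

section \<open>Binomial coefficients modulo a prime\<close>

lemma one_plus_monom_power:
  "(1 + monom 1 d :: 'a::comm_ring_1 poly) ^ n = (\<Sum>i\<le>n. monom (of_nat (n choose i)) (d * i))"
proof -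
  have "(monom 1 d + 1 :: 'a poly) ^ n = (\<Sum>i\<le>n. of_nat (n choose i) * monom 1 d ^ i * 1 ^ (n - i))"
    by (rule binomial_ring)
  also have "\<dots> = (\<Sum>i\<le>n. monom (of_nat (n choose i)) (d * i))"
    by (intro sum.cong refl) (simp add: monom_power of_nat_poly smult_monom)
  finally show ?thesis by (simp add: add.commute)
qed

text \<open>Lucas' theorem for one digit, by comparing coefficients in
  \<open>(1 + X) ^ (p * a + r) = (1 + X ^ p) ^ a * (1 + X) ^ r\<close>.\<close>

lemma of_nat_binomial_lucas:
  fixes p a b r t :: nat
  assumes p: "prime CHAR('a::comm_ring_1)" "p = CHAR('a)" and r: "r < p" and t: "t < p"
  shows "(of_nat ((p * a + r) choose (p * b + t)) :: 'a) = of_nat (a choose b) * of_nat (r choose t)"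
proof -
  let ?X = "monom 1 1 :: 'a poly"
  have "(1 + ?X) ^ p = 1 ^ p + ?X ^ p"
    by (rule freshmans_dream) (use p in auto)
  then have "(1 + ?X) ^ (p * a + r) = (1 + monom 1 p) ^ a * (1 + ?X) ^ r"
    by (simp add: power_add power_mult monom_power)
  also have "\<dots> = (\<Sum>i\<le>a. \<Sum>l\<le>r. monom (of_nat (a choose i) * of_nat (r choose l)) (p * i + l))"
    by (simp only: one_plus_monom_power sum_product mult_monom) simp
  finally have eq: "(\<Sum>i\<le>p * a + r. monom (of_nat ((p * a + r) choose i)) i)
      = (\<Sum>i\<le>a. \<Sum>l\<le>r. monom (of_nat (a choose i) * of_nat (r choose l) :: 'a) (p * i + l))"
    by (simp add: one_plus_monom_power)
  have "(of_nat ((p * a + r) choose (p * b + t)) :: 'a)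
      = coeff (\<Sum>i\<le>p * a + r. monom (of_nat ((p * a + r) choose i)) i) (p * b + t)"
    by (simp add: coeff_sum binomial_eq_0)
  also have "\<dots> = (\<Sum>i\<le>a. \<Sum>l\<le>r. if i = b \<and> l = t then of_nat (a choose i) * of_nat (r choose l) else 0)"
    unfolding eq coeff_sum coeff_monom
  proof (intro sum.cong refl)
    fix i l assume "l \<in> {..r}"
    then have l: "l < p" using r by simp
    have "p * i + l = p * b + t \<longleftrightarrow> i = b \<and> l = t"
    proof
      assume e: "p * i + l = p * b + t"
      have "(p * i + l) div p = i" "(p * b + t) div p = b" using l t by simp_all
      then show "i = b \<and> l = t" using e by auto
    qed auto
    then show "(if p * i + l = p * b + t then of_nat (a choose i) * of_nat (r choose l) else 0) =
        (if i = b \<and> l = t then of_nat (a choose i) * of_nat (r choose l) else (0::'a))" by simp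
  qed
  also have "\<dots> = (\<Sum>i\<le>a. if i = b then (\<Sum>l\<le>r. if l = t then of_nat (a choose i) * of_nat (r choose l) else 0) else 0)"
    by (intro sum.cong refl) auto
  also have "\<dots> = of_nat (a choose b) * of_nat (r choose t)"
    by (auto simp: binomial_eq_0)
  finally show ?thesis .
qed

text \<open>Each use of Lucas' theorem strips one digit, the lower digits of \<open>p ^ M\<close>
  being \<open>0\<close>, until \<open>choose 1\<close> remains.\<close>

lemma of_nat_binomial_prime_power:
  fixes p n M :: nat
  assumes p: "prime CHAR('a::comm_ring_1)" "p = CHAR('a)"
  shows "(of_nat (n choose p ^ M) :: 'a) = of_nat (n div p ^ M)"
proof (induction M arbitrary: n)
  case (Suc M)
  have p0: "p > 0" using p prime_gt_0_nat by blast
  have "(of_nat ((p * (n div p) + n mod p) choose (p * p ^ M + 0)) :: 'a)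
      = of_nat ((n div p) choose p ^ M) * of_nat ((n mod p) choose 0)"
    by (rule of_nat_binomial_lucas) (use p p0 in auto)
  then show ?case using Suc.IH[of "n div p"] by (simp add: div_mult2_eq)
qed simp

lemma of_nat_binomial_nonzero:
  assumes p: "prime CHAR('a::idom)" and n: "n < CHAR('a)" "k \<le> n"
  shows "(of_nat (n choose k) :: 'a) \<noteq> 0"
proof
  assume "(of_nat (n choose k) :: 'a) = 0"
  then have "CHAR('a) dvd n choose k" by (simp add: of_nat_eq_0_iff_char_dvd)
  also have "n choose k dvd fact n"
    using n binomial_fact_lemma[of k n] by (metis dvd_triv_right)
  finally show False using p n by (simp add: prime_dvd_fact_iff)
qed

text \<open>Corresponding digits of \<open>u\<close> and \<open>v\<close> add up to
  \<open>p - 1\<close>, so adding the \<open>d c\<close> to the digits of \<open>v\<close> produces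
  no carry. Lucas' theorem then factors the binomial coefficient into nonzero digitwise
  ones.\<close>

lemma of_nat_binomial_add_nonzero:
  fixes p u v M :: nat
  assumes p: "prime CHAR('a::idom)" "p = CHAR('a)"
    and "u + v = p ^ M - 1" "\<And>c. c < M \<Longrightarrow> d c \<le> u div p ^ c mod p"
  shows "(of_nat ((v + (\<Sum>c<M. d c * p ^ c)) choose (\<Sum>c<M. d c * p ^ c)) :: 'a) \<noteq> 0"
  using assms(3,4)
proof (induction M arbitrary: u v d)
  case 0
  then show ?case by simp
next
  case (Suc M)
  have p2: "p \<ge> 2" using p prime_ge_2_nat by simp
  define u' where "u' = u div p"
  define v' where "v' = v div p"
  have u: "u = p * u' + u mod p" and v: "v = p * v' + v mod p" by (auto simp: u'_def v'_def)
  have up: "u mod p < p" and vp: "v mod p < p" using p2 by auto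
  have full: "p ^ Suc M - 1 = p * (p ^ M - 1) + (p - 1)"
    using p2 by (simp add: algebra_simps diff_mult_distrib2)
  have e: "p * (u' + v') + (u mod p + v mod p) = p * (p ^ M - 1) + (p - 1)"
    using Suc.prems(1) full u v by (metis add.assoc add.left_commute distrib_left)
  have r: "u mod p + v mod p = p - 1"
  proof -
    have "(p * (u' + v') + (u mod p + v mod p)) mod p = (p * (p ^ M - 1) + (p - 1)) mod p"
      by (simp only: e)
    also have "\<dots> = (p - 1) mod p" by (rule mod_mult_self4)
    also have "(p * (u' + v') + (u mod p + v mod p)) mod p = (u mod p + v mod p) mod p"
      by (rule mod_mult_self4)
    finally have *: "(u mod p + v mod p) mod p = p - 1" using p2 by simp
    have "u mod p + v mod p < p + (p - 1)" using up vp by linarith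
    then show ?thesis using * up vp p2
      by (cases "u mod p + v mod p < p") (auto simp: le_mod_geq)
  qed
  have "p * (u' + v') = p * (p ^ M - 1)" using e unfolding r by (rule add_right_imp_eq)
  then have uv: "u' + v' = p ^ M - 1" using p2 by (subst (asm) nat_mult_eq_cancel1) auto
  define w where "w = (\<Sum>c<M. d (Suc c) * p ^ c)"
  have d0: "d 0 \<le> u mod p" using Suc.prems(2)[of 0] by simp
  have W: "(\<Sum>c<Suc M. d c * p ^ c) = p * w + d 0"
    by (simp add: sum.lessThan_Suc_shift w_def sum_distrib_left mult_ac del: sum.lessThan_Suc)
  have nz1: "(of_nat ((v' + w) choose w) :: 'a) \<noteq> 0"
    unfolding w_def
  proof (rule Suc.IH[OF uv])
    fix c assume "c < M"
    then show "d (Suc c) \<le> u' div p ^ c mod p"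
      using Suc.prems(2)[of "Suc c"] by (simp add: u'_def div_mult2_eq)
  qed
  have lt: "v mod p + d 0 < p" using d0 r p2 by linarith
  then have nz2: "(of_nat ((v mod p + d 0) choose d 0) :: 'a) \<noteq> 0"
    by (intro of_nat_binomial_nonzero) (use p in auto)
  have luc: "(of_nat ((p * (v' + w) + (v mod p + d 0)) choose (p * w + d 0)) :: 'a)
      = of_nat ((v' + w) choose w) * of_nat ((v mod p + d 0) choose d 0)"
    by (rule of_nat_binomial_lucas) (use p lt in auto)
  have eq: "v + (p * w + d 0) = p * (v' + w) + (v mod p + d 0)"
    using v distrib_left[of p v' w] by linarith
  show ?case unfolding W eq luc using nz1 nz2 by simp
qed

section \<open>Newton's identities with multiplicities\<close>

text \<open>\<open>- G\<close> is the logarithmic derivative \<open>- a / (1 - a X)\<close> of the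
  linear factor, expanded as a geometric series.\<close>

lemma fps_deriv_linear_power:
  fixes a :: "'a::comm_ring_1"
  defines "G \<equiv> Abs_fps (\<lambda>n. a ^ Suc n)"
  shows "fps_deriv ((1 - fps_const a * fps_X) ^ n) = - ((1 - fps_const a * fps_X) ^ n * (of_nat n * G))"
proof (induction n)
  case (Suc n)
  let ?f = "1 - fps_const a * fps_X"
  have "?f * G = fps_const a"
  proof (rule fps_ext)
    fix k
    show "(?f * G) $ k = fps_const a $ k"
      by (cases k) (simp_all add: G_def ring_distribs mult.assoc)
  qed
  then have d: "fps_deriv ?f = - (?f * G)" by simp
  have "fps_deriv (?f ^ Suc n) = fps_deriv ?f * ?f ^ n + ?f * fps_deriv (?f ^ n)"
    by simp
  also have "\<dots> = - (?f ^ Suc n * (of_nat (Suc n) * G))"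
    unfolding Suc.IH d by (simp add: algebra_simps)
  finally show ?case .
qed simp

text \<open>The derivative of \<open>F\<close> is \<open>- F * P\<close>, because logarithmic
  derivatives of factors add up; the claim compares coefficients. The factor \<open>of_nat k\<close>
  stays undivided, as it may vanish in characteristic \<open>p\<close>.\<close>

lemma newton_identity:
  fixes a :: "'x \<Rightarrow> 'a::comm_ring_1" and c :: "'x \<Rightarrow> nat"
  assumes "finite A"
  defines "E \<equiv> (\<Prod>x\<in>A. [:1, - a x:] ^ c x)"
  shows "of_nat k * coeff E k = - (\<Sum>i<k. coeff E i * (\<Sum>x\<in>A. of_nat (c x) * a x ^ (k - i)))"
proof (cases k)
  case (Suc n)
  define F where "F = fps_of_poly E"
  define P where "P = (\<Sum>x\<in>A. of_nat (c x) * Abs_fps (\<lambda>n. a x ^ Suc n))"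
  have F: "F = (\<Prod>x\<in>A. (1 - fps_const (a x) * fps_X) ^ c x)"
    by (simp add: F_def E_def fps_of_poly_prod fps_of_poly_power fps_of_poly_pCons flip: fps_const_neg)
  have "fps_deriv (\<Prod>x\<in>B. (1 - fps_const (a x) * fps_X) ^ c x)
      = - ((\<Prod>x\<in>B. (1 - fps_const (a x) * fps_X) ^ c x) * (\<Sum>x\<in>B. of_nat (c x) * Abs_fps (\<lambda>n. a x ^ Suc n)))"
    if "finite B" for B
    using that
  proof (induction B rule: finite_induct)
    case (insert x B)
    let ?f = "\<lambda>x. (1 - fps_const (a x) * fps_X) ^ c x" and ?G = "\<lambda>x. of_nat (c x) * Abs_fps (\<lambda>n. a x ^ Suc n)"
    have F: "prod ?f (insert x B) = ?f x * prod ?f B" and G: "sum ?G (insert x B) = ?G x + sum ?G B"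
      using insert.hyps by (rule prod.insert, rule sum.insert)
    have alg: "u * - (v * s) + - (u * t) * v = - (u * v * (t + s))" for u v s t :: "'a fps"
      by (simp add: algebra_simps)
    show ?case
      unfolding F G by (subst fps_deriv_mult) (unfold insert.IH fps_deriv_linear_power, rule alg)
  qed simp
  from this[OF assms(1)] have dF: "fps_deriv F = - (F * P)" by (simp only: F P_def)
  have Pn: "P $ j = (\<Sum>x\<in>A. of_nat (c x) * a x ^ Suc j)" for j
    by (simp add: P_def fps_sum_nth fps_of_nat[symmetric])
  have "of_nat k * coeff E k = fps_deriv F $ n"
    by (simp add: F_def Suc)
  also have "\<dots> = - (\<Sum>i=0..n. F $ i * P $ (n - i))"
    by (simp add: dF fps_mult_nth)
  also have "(\<Sum>i=0..n. F $ i * P $ (n - i)) = (\<Sum>i<k. coeff E i * (\<Sum>x\<in>A. of_nat (c x) * a x ^ (k - i)))"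
    unfolding Pn F_def fps_of_poly_nth
    by (intro sum.cong) (auto simp: Suc Suc_diff_le)
  finally show ?thesis .
qed simp

section \<open>Leading coefficients and degrees of products of linear factors\<close>

lemma coeff_mult_degree_le:
  fixes f g :: "'a::comm_semiring_1 poly"
  assumes "degree f \<le> m" "degree g \<le> n"
  shows "coeff (f * g) (m + n) = coeff f m * coeff g n"
proof -
  have "coeff (f * g) (m + n) = (\<Sum>i\<le>m + n. coeff f i * coeff g (m + n - i))" by (rule coeff_mult)
  also have "\<dots> = (\<Sum>i\<in>{m}. coeff f i * coeff g (m + n - i))"
  proof (rule sum.mono_neutral_right)
    show "\<forall>i\<in>{..m + n} - {m}. coeff f i * coeff g (m + n - i) = 0"
    proof
      fix i assume "i \<in> {..m + n} - {m}"
      then have "i > m \<or> m + n - i > n" by auto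
      then show "coeff f i * coeff g (m + n - i) = 0" using assms by (auto simp: coeff_eq_0)
    qed
  qed auto
  finally show ?thesis by simp
qed

text \<open>As far as leading terms in \<open>X\<close> are concerned, each factor behaves like
  \<open>1 - X ^ d * T\<close>, so the coefficients are those of a power of \<open>1 - T\<close>.
  The invariant \<open>Q\<close> also carries the degree bound \<open>d * k\<close>, which makes
  leading coefficients multiplicative.\<close>

lemma coeff_prod_linear_monic:
  fixes a :: "'x \<Rightarrow> 'a::comm_ring_1 poly" and c :: "'x \<Rightarrow> nat"
  assumes "finite A" and deg: "\<And>x. x \<in> A \<Longrightarrow> degree (a x) \<le> d"
    and lead: "\<And>x. x \<in> A \<Longrightarrow> coeff (a x) d = 1"
  defines "E \<equiv> (\<Prod>x\<in>A. [:1, - a x:] ^ c x)"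
  shows "coeff (coeff E k) (d * k) = (- 1) ^ k * of_nat ((\<Sum>x\<in>A. c x) choose k)"
proof -
  define Q where "Q = (\<lambda>(F :: 'a poly poly) s. \<forall>k. degree (coeff F k) \<le> d * k \<and>
    coeff (coeff F k) (d * k) = (- 1) ^ k * of_nat (s choose k))"
  have Q1: "Q 1 0" by (auto simp: Q_def coeff_1 binomial_eq_0)
  have step: "Q ([:1, - b:] * F) (Suc s)" if "Q F s" and b: "degree b \<le> d" "coeff b d = 1" for F s b
    unfolding Q_def
  proof (intro allI)
    fix k
    show "degree (coeff ([:1, - b:] * F) k) \<le> d * k \<and>
      coeff (coeff ([:1, - b:] * F) k) (d * k) = (- 1) ^ k * of_nat (Suc s choose k)"
    proof (cases k)
      case 0
      then show ?thesis using \<open>Q F s\<close> unfolding Q_def by (auto dest!: spec[of _ 0])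
    next
      case (Suc l)
      have Fd: "degree (coeff F i) \<le> d * i"
        and Fl: "coeff (coeff F i) (d * i) = (- 1) ^ i * of_nat (s choose i)" for i
        using \<open>Q F s\<close> by (auto simp: Q_def)
      have c: "coeff ([:1, - b:] * F) k = coeff F k - b * coeff F l"
        by (simp add: Suc)
      have "degree (b * coeff F l) \<le> d + d * l"
        using degree_mult_le[of b "coeff F l"] b(1) Fd[of l] by linarith
      then have 1: "degree (coeff ([:1, - b:] * F) k) \<le> d * k"
        unfolding c using Fd[of k] by (intro degree_diff_le) (auto simp: Suc)
      have "coeff (b * coeff F l) (d + d * l) = (- 1) ^ l * of_nat (s choose l)"
        by (simp add: coeff_mult_degree_le[OF b(1) Fd] b Fl)
      then have "coeff (coeff ([:1, - b:] * F) k) (d * k) = (- 1) ^ k * of_nat (Suc s choose k)"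
        unfolding c using Fl[of k] by (simp add: Suc algebra_simps)
      with 1 show ?thesis by blast
    qed
  qed
  have pow: "Q ([:1, - b:] ^ n * F) (s + n)" if "Q F s" and b: "degree b \<le> d" "coeff b d = 1" for F s b n
  proof (induction n)
    case (Suc n)
    then show ?case using step[OF Suc.IH b] by (simp only: power_Suc mult.assoc add_Suc_right)
  qed (use that in simp)
  have "Q (\<Prod>x\<in>B. [:1, - a x:] ^ c x) (\<Sum>x\<in>B. c x)" if "finite B" "B \<subseteq> A" for B
    using that
  proof (induction B rule: finite_induct)
    case empty
    then show ?case using Q1 by simp
  next
    case (insert x B)
    then have "Q ([:1, - a x:] ^ c x * (\<Prod>x\<in>B. [:1, - a x:] ^ c x)) ((\<Sum>x\<in>B. c x) + c x)"
      by (intro pow) (auto intro: deg lead)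
    then show ?case using insert by (simp add: add.commute)
  qed
  from this[OF assms(1) subset_refl] show ?thesis by (simp add: Q_def E_def)
qed

lemma degree_prod_linear_le:
  fixes a :: "'x \<Rightarrow> 'a::comm_ring_1"
  assumes "finite A"
  shows "degree (\<Prod>x\<in>A. [:1, - a x:] ^ c x) \<le> (\<Sum>x\<in>A. c x)"
proof -
  have "degree (\<Prod>x\<in>A. [:1, - a x:] ^ c x) \<le> sum (degree \<circ> (\<lambda>x. [:1, - a x:] ^ c x)) A"
    by (rule degree_prod_sum_le[OF assms])
  also have "\<dots> \<le> (\<Sum>x\<in>A. c x)"
  proof (rule sum_mono)
    fix x
    have "degree ([:1, - a x:] ^ c x) \<le> degree [:1, - a x:] * c x" by (rule degree_power_le)
    also have "\<dots> \<le> 1 * c x" by (intro mult_le_mono1) simp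
    finally show "(degree \<circ> (\<lambda>x. [:1, - a x:] ^ c x)) x \<le> c x" by simp
  qed
  finally show ?thesis .
qed

section \<open>Embedding a vector space into the algebraic closure\<close>

text \<open>Multiplication by a nonzero \<open>x\<close> permutes the nonzero elements, so comparing
  their products gives \<open>x ^ (CARD('a) - 1) = 1\<close>.\<close>

lemma field_power_CARD:
  fixes x :: "'a::{field,finite}"
  shows "x ^ CARD('a) = x"
proof (cases "x = 0")
  case False
  let ?P = "\<Prod>y\<in>UNIV - {0::'a}. y"
  have "(\<Prod>y\<in>UNIV - {0}. x * y) = ?P"
    by (rule prod.reindex_bij_witness[of _ "\<lambda>y. y / x" "\<lambda>y. x * y"]) (use False in auto)
  then have "x ^ (CARD('a) - 1) * ?P = ?P"
    by (simp add: prod.distrib card_Diff_singleton)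
  then have "x ^ (CARD('a) - 1) = 1" by simp
  then show ?thesis
    using power_Suc[of x "CARD('a) - 1"] by simp
qed simp

text \<open>Since \<open>n\<close> is \<open>0\<close> in the field, \<open>X ^ n - X\<close> has
  derivative \<open>- 1\<close> and hence no repeated root; it splits into \<open>n\<close> distinct
  linear factors.\<close>

lemma card_power_fixed_points_ge:
  assumes n: "of_nat n = (0 :: 'a::alg_closed_field)" "n \<ge> 2"
  shows "finite {z :: 'a. z ^ n = z}" "n \<le> card {z :: 'a. z ^ n = z}"
proof -
  define f :: "'a poly" where "f = monom 1 n - monom 1 1"
  have "degree (monom (1::'a) 1) < degree (monom (1::'a) n)"
    using n by (simp add: degree_monom_eq)
  then have deg: "degree f = n"
    using degree_add_eq_left[of "- monom (1::'a) 1" "monom 1 n"] by (simp add: f_def degree_monom_eq)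
  then have f0: "f \<noteq> 0" using n by auto
  have pd: "pderiv f = - 1"
    using n by (simp add: f_def pderiv_diff pderiv_monom)
  obtain A where A: "size A = n" "f = smult (lead_coeff f) (\<Prod>x\<in>#A. [:-x, 1:])"
    using alg_closed_imp_factorization[OF f0] deg by auto
  have roots: "{z. z ^ n = z} = {z. poly f z = 0}"
    by (auto simp: f_def poly_monom)
  then show fin: "finite {z :: 'a. z ^ n = z}" using poly_roots_finite[OF f0] by simp
  have sub: "set_mset A \<subseteq> {z. z ^ n = z}"
    unfolding roots
  proof
    fix x assume "x \<in># A"
    then obtain B where "A = add_mset x B" by (rule mset_add)
    then show "x \<in> {z. poly f z = 0}" by (subst A(2)) simp
  qed
  have "count A x \<le> 1" for x
  proof (rule ccontr)
    assume "\<not> count A x \<le> 1"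
    then have "replicate_mset 2 x \<subseteq># A" by (simp flip: count_le_replicate_mset_subset_eq)
    then obtain B where "A = replicate_mset 2 x + B" by (metis subset_mset.add_diff_inverse)
    then have "A = add_mset x (add_mset x B)" by (simp add: numeral_2_eq_2)
    then have "(\<Prod>x\<in>#A. [:-x, 1:]) = [:-x, 1:] * ([:-x, 1:] * (\<Prod>x\<in>#B. [:-x, 1:]))"
      by (simp only: image_mset_add_mset prod_mset.add_mset)
    then obtain g where g: "f = [:-x, 1:] * ([:-x, 1:] * g)"
      using A(2) by (metis mult_smult_right)
    have "poly (pderiv f) x = 0" by (simp only: g pderiv_mult poly_add poly_mult) simp
    then show False by (simp add: pd)
  qed
  then have "n \<le> card (set_mset A)"
    using A(1) unfolding size_multiset_overloaded_eq
    using sum_bounded_above[of "set_mset A" "count A" 1] by simp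
  also have "\<dots> \<le> card {z :: 'a. z ^ n = z}" by (rule card_mono[OF fin sub])
  finally show "n \<le> card {z :: 'a. z ^ n = z}" .
qed

lemma of_nat_CARD_field [simp]: "of_nat CARD('a) = (0 :: 'a::{field,finite})"
  by (simp add: of_nat_eq_0_iff_char_dvd CHAR_dvd_CARD)

text \<open>By counting: for \<open>n < m\<close> the span of \<open>n\<close> elements has at most
  \<open>CARD('k) ^ n < Q\<close> members, while \<open>z ^ Q = z\<close> has at least
  \<open>Q\<close> solutions, so some solution extends the independent family.\<close>

lemma exists_independent_in_alg_closure:
  fixes m n :: nat
  defines "Q \<equiv> CARD('k::{field,finite}) ^ m"
  assumes "n \<le> m" "m \<ge> 1"
  shows "\<exists>y :: nat \<Rightarrow> 'k alg_closure. (\<forall>i<n. y i ^ Q = y i) \<and>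
    (\<forall>c :: nat \<Rightarrow> 'k. (\<Sum>i<n. to_ac (c i) * y i) = 0 \<longrightarrow> (\<forall>i<n. c i = 0))"
  using assms(2)
proof (induction n)
  case (Suc n)
  from Suc obtain y :: "nat \<Rightarrow> 'k alg_closure" where y: "\<And>i. i < n \<Longrightarrow> y i ^ Q = y i"
    and ind: "\<And>c :: nat \<Rightarrow> 'k. (\<Sum>i<n. to_ac (c i) * y i) = 0 \<Longrightarrow> \<forall>i<n. c i = 0" by auto
  have q2: "CARD('k) \<ge> 2"
    using card_mono[of "UNIV :: 'k set" "{0, 1}"] by simp
  let ?K = "{z :: 'k alg_closure. z ^ Q = z}"
  let ?C = "{..<n} \<rightarrow>\<^sub>E (UNIV :: 'k set)"
  let ?span = "(\<lambda>c. \<Sum>i<n. to_ac (c i) * y i) ` ?C"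
  have "card ?span \<le> card ?C" by (intro card_image_le finite_PiE) auto
  also have "\<dots> = CARD('k) ^ n" by (simp add: card_PiE)
  also have "\<dots> < Q" unfolding Q_def using q2 Suc.prems by (intro power_strict_increasing) auto
  also have "Q \<le> card ?K"
  proof (rule card_power_fixed_points_ge(2))
    have "of_nat Q = (0 :: 'k)" unfolding Q_def using \<open>m \<ge> 1\<close> by simp
    then show "of_nat Q = (0 :: 'k alg_closure)" by (metis to_ac_0 to_ac_of_nat)
    have "CARD('k) ^ 1 \<le> Q" unfolding Q_def using q2 \<open>m \<ge> 1\<close> by (intro power_increasing) auto
    then show "2 \<le> Q" using q2 by simp
  qed
  finally have less: "card ?span < card ?K" .
  have "finite ?span" by (intro finite_imageI finite_PiE) auto
  then have "\<not> ?K \<subseteq> ?span" using card_mono[of ?span ?K] less by linarith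
  then obtain z where z: "z ^ Q = z" "z \<notin> ?span" by blast
  have "\<forall>i<Suc n. c i = 0" if c: "(\<Sum>i<Suc n. to_ac (c i) * (y(n := z)) i) = 0" for c :: "nat \<Rightarrow> 'k"
  proof -
    have c': "(\<Sum>i<n. to_ac (c i) * y i) + to_ac (c n) * z = 0"
      using c by simp
    have "c n = 0"
    proof (rule ccontr)
      assume nz: "c n \<noteq> 0"
      have "z = - (\<Sum>i<n. to_ac (c i) * y i) / to_ac (c n)"
        using c' nz by (simp add: field_simps eq_neg_iff_add_eq_0 add.commute)
      also have "\<dots> = (\<Sum>i<n. to_ac (restrict (\<lambda>i. - c i / c n) {..<n} i) * y i)"
        by (simp add: sum_negf[symmetric] sum_divide_distrib divide_simps)
      also have "\<dots> \<in> ?span" by (intro imageI) (simp add: PiE_iff extensional_def)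
      finally show False using z by simp
    qed
    then show ?thesis using ind[of c] c' by (auto simp: less_Suc_eq)
  qed
  then show ?case using y z by (intro exI[of _ "y(n := z)"]) (auto simp: less_Suc_eq)
qed simp

text \<open>The coordinates are combined with independent solutions of \<open>y ^ Q = y\<close>.
  Raising to the power \<open>Q\<close> is additive in characteristic \<open>p\<close> and fixes
  \<open>'k\<close>, so it fixes the whole image.\<close>

lemma exists_linear_embedding_alg_closure:
  fixes p h :: nat
  assumes p: "prime p" "CARD('k::{field,finite}) = p ^ h" "CHAR('k) = p"
  shows "\<exists>\<phi> :: 'k ^ 'm::finite \<Rightarrow> 'k alg_closure. (\<forall>x y. \<phi> (x + y) = \<phi> x + \<phi> y) \<and>
    (\<forall>t x. \<phi> (t *s x) = to_ac t * \<phi> x) \<and> inj \<phi> \<and> (\<forall>x. \<phi> x ^ (CARD('k) ^ CARD('m)) = \<phi> x)"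
proof -
  define Q where "Q = CARD('k) ^ CARD('m)"
  have "CARD('m) \<ge> 1" by (simp add: Suc_le_eq)
  then obtain y :: "nat \<Rightarrow> 'k alg_closure" where y: "\<And>i. i < CARD('m) \<Longrightarrow> y i ^ Q = y i"
    and ind: "\<And>c :: nat \<Rightarrow> 'k. (\<Sum>i<CARD('m). to_ac (c i) * y i) = 0 \<Longrightarrow> \<forall>i<CARD('m). c i = 0"
    using exists_independent_in_alg_closure[of "CARD('m)" "CARD('m)", where 'k = 'k] by (auto simp: Q_def)
  obtain g :: "'m \<Rightarrow> nat" where g: "bij_betw g UNIV {..<CARD('m)}"
    using ex_bij_betw_finite_nat[of "UNIV :: 'm set"] by (auto simp: lessThan_atLeast0)
  define \<phi> :: "'k ^ 'm \<Rightarrow> 'k alg_closure" where "\<phi> = (\<lambda>x. \<Sum>i\<in>UNIV. to_ac (x $ i) * y (g i))"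
  have add: "\<phi> (u + v) = \<phi> u + \<phi> v" for u v
    by (simp add: \<phi>_def sum.distrib algebra_simps)
  have smul: "\<phi> (t *s u) = to_ac t * \<phi> u" for t u
    by (simp add: \<phi>_def sum_distrib_left algebra_simps)
  have ker: "u = 0" if "\<phi> u = 0" for u
  proof -
    let ?c = "\<lambda>i. u $ inv_into UNIV g i"
    have inv: "inv_into UNIV g (g i) = i" for i
      using g by (simp add: bij_betw_def)
    have "(\<Sum>i<CARD('m). to_ac (?c i) * y i) = (\<Sum>i\<in>UNIV. to_ac (?c (g i)) * y (g i))"
      by (rule sum.reindex_bij_betw[OF g, symmetric])
    also have "\<dots> = 0" using that by (simp add: inv \<phi>_def)
    finally have "\<forall>i<CARD('m). ?c i = 0" by (rule ind)
    moreover have "g i < CARD('m)" for i using g by (auto simp: bij_betw_def)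
    ultimately have "u $ i = 0" for i using inv[of i] by metis
    then show "u = 0" by (simp add: vec_eq_iff)
  qed
  have "inj \<phi>"
  proof (rule injI)
    fix u v assume "\<phi> u = \<phi> v"
    moreover have "\<phi> u = \<phi> (u - v) + \<phi> v" by (simp flip: add)
    ultimately show "u = v" using ker[of "u - v"] by simp
  qed
  moreover have "\<phi> u ^ Q = \<phi> u" for u
  proof -
    have Q: "Q = CHAR('k alg_closure) ^ (h * CARD('m))"
      by (simp add: Q_def p power_mult)
    have "to_ac t ^ Q = (to_ac t :: 'k alg_closure)" for t :: 'k
    proof -
      have "t ^ (CARD('k) ^ n) = t" for n
        by (induction n) (simp_all add: power_mult field_power_CARD)
      then show ?thesis unfolding Q_def by (metis to_ac_power)
    qed
    moreover have "y (g i) ^ Q = y (g i)" for i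
      using y[of "g i"] g by (auto simp: bij_betw_def)
    ultimately show ?thesis
      unfolding \<phi>_def by (subst freshmans_dream_sum'[OF _ Q]) (simp_all add: p power_mult_distrib)
  qed
  ultimately show ?thesis using add smul unfolding Q_def by blast
qed

section \<open>Lacunary power sums\<close>

lemma digit_wt_split:
  assumes "p \<ge> 2"
  shows "digit_wt p h j n = digit_wt p h j (n mod p ^ M) + digit_wt p h (j + M) (n div p ^ M)"
proof (induction M arbitrary: j n)
  case (Suc M)
  have "n mod p ^ Suc M = p * (n div p mod p ^ M) + n mod p"
    by (simp add: mod_mult2_eq)
  then have "digit_wt p h j (n mod p ^ Suc M) = (n mod p) * p ^ (j mod h) + digit_wt p h (Suc j) (n div p mod p ^ M)"
    using assms by (simp add: digit_wt_rec)
  moreover have "digit_wt p h j n = (n mod p) * p ^ (j mod h) + digit_wt p h (Suc j) (n div p)"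
    by (rule digit_wt_div_mod[OF assms])
  moreover have "n div p ^ Suc M = n div p div p ^ M" by (simp add: div_mult2_eq)
  ultimately show ?case using Suc.IH[of "Suc j" "n div p"] by simp
qed simp

lemma digit_wt_digit:
  assumes "p \<ge> 2" "t < p"
  shows "digit_wt p h j t = t * p ^ (j mod h)"
  using digit_wt_rec[OF assms, of h j 0] by simp

lemma digit_wt_pos:
  assumes "p \<ge> 2" "n > 0"
  shows "digit_wt p h j n > 0"
  using assms(2)
proof (induction n arbitrary: j rule: less_induct)
  case (less n)
  show ?case
  proof (cases "n mod p = 0")
    case True
    then have "n div p > 0" "n div p < n" using less.prems assms(1) by (auto simp: div_greater_zero_iff dvd_imp_le mod_eq_0_iff_dvd)
    then show ?thesis using less.IH[of "n div p" "Suc j"] digit_wt_div_mod[OF assms(1), of h j n] by simp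
  next
    case False
    then show ?thesis using digit_wt_div_mod[OF assms(1), of h j n] assms(1) by simp
  qed
qed

text \<open>By Lucas' theorem a binomial coefficient that is nonzero modulo \<open>p\<close> forces
  each digit of \<open>k\<close> to be at most the corresponding digit of \<open>n\<close>.\<close>

lemma digit_wt_le_of_binomial:
  assumes p: "prime CHAR('a::idom)" "p = CHAR('a)" and "(of_nat (n choose k) :: 'a) \<noteq> 0"
  shows "digit_wt p h j k \<le> digit_wt p h j n"
  using assms(3)
proof (induction n arbitrary: k j rule: less_induct)
  case (less n)
  have p2: "p \<ge> 2" using p prime_ge_2_nat by simp
  show ?case
  proof (cases "n = 0")
    case True
    then show ?thesis using less.prems by (cases k) auto
  next
    case False
    have "(of_nat ((p * (n div p) + n mod p) choose (p * (k div p) + k mod p)) :: 'a)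
        = of_nat ((n div p) choose (k div p)) * of_nat ((n mod p) choose (k mod p))"
      by (rule of_nat_binomial_lucas) (use p p2 in auto)
    then have 1: "(of_nat ((n div p) choose (k div p)) :: 'a) \<noteq> 0"
      and 2: "(of_nat ((n mod p) choose (k mod p)) :: 'a) \<noteq> 0"
      using less.prems by auto
    have "k mod p \<le> n mod p"
      using 2 by (metis binomial_eq_0 not_le of_nat_0)
    then have "(k mod p) * p ^ (j mod h) \<le> (n mod p) * p ^ (j mod h)" by simp
    moreover have "n div p < n" using False p2 by simp
    then have "digit_wt p h (Suc j) (k div p) \<le> digit_wt p h (Suc j) (n div p)"
      using 1 by (rule less.IH)
    ultimately show ?thesis
      unfolding digit_wt_div_mod[OF p2, of h j n] digit_wt_div_mod[OF p2, of h j k] by (rule add_mono)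
  qed
qed

text \<open>Write \<open>e = i * (q - 1)\<close> as \<open>t * q ^ m + r\<close>. The complement
  \<open>rc\<close> of \<open>r\<close> has weighted digit sum at most \<open>t * g\<close>, so its
  last digit \<open>y\<close> is at most \<open>t\<close>. Reducing
  \<open>e + 1 + rc = (t + 1) * q ^ m\<close> modulo \<open>p\<close> shows that \<open>i\<close> is
  congruent to \<open>y + 1\<close>; the cases \<open>t = y\<close>, \<open>t = y + 1\<close> and
  larger \<open>t\<close> are then settled by size.\<close>

lemma digit_wt_ge_imp_lacunary:
  fixes p h m N J i j :: nat
  defines "q \<equiv> p ^ h"
  assumes p: "p > 2" and h: "h \<ge> 1" and m: "m \<ge> 1"
    and N: "N * (q - 1) = q ^ m - 1" and J: "J * (q - 1) \<le> q ^ (m - 1)"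
    and small: "i * (q - 1) < p * q ^ m"
    and wt: "digit_wt p h j (i * (q - 1)) \<ge> m * (q - 1)"
  shows "(i mod p \<ge> 1 \<and> i = (i mod p) * N) \<or> i > (i mod p) * N + J"
proof -
  have p2: "p \<ge> 2" using p by simp
  define e where "e = i * (q - 1)"
  define t where "t = e div q ^ m"
  define r where "r = e mod q ^ m"
  define rc where "rc = q ^ m - 1 - r"
  define g where "g = p ^ (j mod h)"
  define k where "k = rc div p"
  define y where "y = rc mod p"
  have qm: "q ^ m = p ^ (m * h)" by (simp add: q_def power_mult[symmetric] mult.commute)
  have q3: "q \<ge> p" using p h self_le_power[of p h] by (simp add: q_def)
  have qpos: "q ^ m > 0" "q - 1 > 0" using q3 p by auto
  have t: "t < p" unfolding t_def using small by (simp add: e_def less_mult_imp_div_less)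
  have r: "r < q ^ m" unfolding r_def using qpos by simp
  have e: "e = t * q ^ m + r" by (simp only: t_def r_def div_mult_mod_eq)
  have e': "e + 1 + rc = (t + 1) * q ^ m" using r by (simp add: e rc_def)
  \<comment> \<open>\<open>t\<close> is a single digit at position \<open>m * h\<close>, which has
    the same weight \<open>g\<close> as position \<open>0\<close>.\<close>
  have "digit_wt p h j e = digit_wt p h j r + t * g"
  proof -
    have "(j + m * h) mod h = j mod h" by simp
    then show ?thesis
      using digit_wt_split[OF p2, of h j e "m * h"] digit_wt_digit[OF p2 t, of h "j + m * h"]
      by (simp add: t_def r_def qm g_def)
  qed
  moreover have "digit_wt p h j r + digit_wt p h j rc = m * (q - 1)"
    by (simp only: rc_def qm digit_wt_compl[OF p2 r[unfolded qm]] digit_wt_full[OF p2 h, folded q_def])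
  ultimately have "digit_wt p h j rc \<le> t * g" using wt by (simp add: e_def)
  then have wrc: "y * g + digit_wt p h (Suc j) k \<le> t * g"
    using digit_wt_div_mod[OF p2, of h j rc] by (simp add: y_def k_def g_def)
  have gpos: "g > 0" using p by (simp add: g_def)
  have "y * g \<le> t * g" using wrc by linarith
  then have yt: "y \<le> t" using gpos by simp
  have yp: "y < p" using p by (simp add: y_def)
  have rc: "rc = p * k + y" by (simp add: y_def k_def)
  have main: "i * (q - 1) + 1 + y + p * k = (t + 1) * q ^ m"
    using e' rc by (simp add: e_def)
  have "p dvd q" "q dvd q ^ m" using h m by (simp_all add: q_def dvd_power)
  then have pq: "p dvd q ^ m" "p dvd q" by (auto intro: dvd_trans)
  have imod: "i mod p = (y + 1) mod p"
  proof -
    have "i * q = i * (q - 1) + i" using q3 p by (simp add: diff_mult_distrib2)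
    then have "i * q + (1 + y + p * k) = (t + 1) * q ^ m + i" using main by linarith
    then have "(i * q + (1 + y + p * k)) mod p = ((t + 1) * q ^ m + i) mod p" by simp
    moreover have "[i * q + (1 + y + p * k) = 0 + (1 + y + 0)] (mod p)"
      by (intro cong_add cong_refl) (use pq in \<open>auto simp: cong_0_iff\<close>)
    moreover have "[(t + 1) * q ^ m + i = 0 + i] (mod p)"
      by (intro cong_add cong_refl) (use pq in \<open>auto simp: cong_0_iff\<close>)
    ultimately show ?thesis by (simp add: unique_euclidean_semiring_class.cong_def)
  qed
  have Jq: "J * (q - 1) < q ^ m"
  proof -
    have "q ^ (m - 1) < q ^ m" using q3 p m by (intro power_strict_increasing) auto
    then show ?thesis using J by simp
  qed
  show ?thesis
  proof (cases "y + 1 = p")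
    case True
    then have 0: "i mod p = 0" using imod by simp
    have "1 \<le> t" using yt True p by simp
    then have "q ^ m \<le> t * q ^ m" by simp
    then have "J * (q - 1) < i * (q - 1)" using Jq e unfolding e_def by linarith
    then show ?thesis using 0 by simp
  next
    case False
    then have \<rho>: "i mod p = y + 1" using imod yp by simp
    have \<rho>N: "(y + 1) * N * (q - 1) + (y + 1) = (y + 1) * q ^ m"
    proof -
      have "N * (q - 1) + 1 = q ^ m" using N qpos by simp
      moreover have "(y + 1) * N * (q - 1) + (y + 1) = (y + 1) * (N * (q - 1) + 1)"
        by (simp only: distrib_left mult.assoc mult_1_right)
      ultimately show ?thesis by simp
    qed
    consider "t = y" | "t = y + 1" | "t \<ge> y + 2" using yt by linarith
    then show ?thesis
    proof cases
      case 1
      \<comment> \<open>With \<open>t = y\<close> the last digit uses up all the available weight,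
        so \<open>rc = y\<close> and \<open>i\<close> is exactly \<open>(y + 1) * N\<close>.\<close>
      then have "digit_wt p h (Suc j) k = 0" using wrc by simp
      then have "k = 0" using digit_wt_pos[OF p2, of k h "Suc j"] by (cases "k = 0") auto
      then have "i * (q - 1) + 1 + y = (y + 1) * q ^ m" using main 1 by simp
      then have "i * (q - 1) = (y + 1) * N * (q - 1)" using \<rho>N by linarith
      then have "i = (y + 1) * N" using qpos(2) by (simp only: mult_cancel2) simp
      then show ?thesis using \<rho> by simp
    next
      case 2
      have kg: "digit_wt p h (Suc j) k \<le> g" using wrc 2 by simp
      \<comment> \<open>Otherwise the \<open>h\<close> leading digits of \<open>p * k\<close> would
        all be \<open>p - 1\<close> and weigh \<open>q - 1\<close> together, while only
        \<open>g \<le> p ^ (h - 1)\<close> is available.\<close>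
      have pk: "p * k < (q - 1) * q ^ (m - 1)"
      proof (rule ccontr)
        assume "\<not> ?thesis"
        then have ge: "q - 1 \<le> p * k div q ^ (m - 1)"
          using q3 p by (simp add: less_eq_div_iff_mult_less_eq)
        have "p * k < q ^ m" using rc r by (simp add: rc_def)
        also have "q ^ m = q * q ^ (m - 1)" using m by (cases m) auto
        finally have "p * k div q ^ (m - 1) < q" by (simp add: less_mult_imp_div_less)
        then have eq: "p * k div q ^ (m - 1) = q - 1" using ge by simp
        have qm1: "q ^ (m - 1) = p ^ ((m - 1) * h)" by (simp add: q_def power_mult[symmetric] mult.commute)
        have "digit_wt p h j (p * k) = digit_wt p h (Suc j) k"
          using digit_wt_rec[OF p2, of 0 h j k] p by simp
        moreover have "digit_wt p h (j + (m - 1) * h) (q - 1) \<le> digit_wt p h j (p * k)"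
          using digit_wt_split[OF p2, of h j "p * k" "(m - 1) * h"] unfolding qm1[symmetric] eq by linarith
        moreover have "digit_wt p h (j + (m - 1) * h) (q - 1) = q - 1"
          using digit_wt_full[OF p2 h, of "j + (m - 1) * h" 1] by (simp add: q_def)
        ultimately have "q - 1 \<le> g" using kg by simp
        also have "g \<le> p ^ (h - 1)"
        proof -
          have "j mod h < h" using h by simp
          then have "j mod h \<le> h - 1" by simp
          then show ?thesis unfolding g_def using p by (intro power_increasing) auto
        qed
        finally have "p ^ h \<le> p ^ (h - 1) + 1" by (simp add: q_def)
        moreover have "p ^ h = p * p ^ (h - 1)" using h by (cases h) auto
        moreover have "3 * p ^ (h - 1) \<le> p * p ^ (h - 1)" using p by (intro mult_le_mono1) simp
        moreover have "p ^ (h - 1) \<ge> 1" using p by simp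
        ultimately show False by linarith
      qed
      have "(q - 1) * q ^ (m - 1) + q ^ (m - 1) = q ^ m"
        using m q3 p by (cases m) (auto simp: algebra_simps diff_mult_distrib2)
      then have "(y + 1) * N * (q - 1) + J * (q - 1) < i * (q - 1)"
        using pk J \<rho>N main 2 by simp
      then have "((y + 1) * N + J) * (q - 1) < i * (q - 1)" by (simp add: algebra_simps)
      then show ?thesis using \<rho> by simp
    next
      case 3
      have "(y + 2) * q ^ m \<le> t * q ^ m" using 3 by (rule mult_le_mono1)
      then have "(y + 2) * q ^ m \<le> i * (q - 1)" using e by (simp add: e_def)
      moreover have "(y + 2) * q ^ m = (y + 1) * q ^ m + q ^ m" by simp
      ultimately have "(y + 1) * N * (q - 1) + J * (q - 1) < i * (q - 1)"
        using Jq \<rho>N by linarith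
      then have "((y + 1) * N + J) * (q - 1) < i * (q - 1)" by (simp add: algebra_simps)
      then show ?thesis using \<rho> by simp
    qed
  qed
qed

text \<open>Induction through Newton's identity, with \<open>c = k mod p\<close>. For
  \<open>k < c * N\<close>, every \<open>r\<close> with \<open>s r \<noteq> 0\<close> leaves an
  index \<open>k - r\<close> below its own multiple of \<open>N\<close>, so all terms vanish. For
  \<open>k\<close> between \<open>c * N\<close> and \<open>c * N + J\<close>, only the terms with
  \<open>r = \<rho> * N\<close> survive, and they share the factor
  \<open>e (k - c * N)\<close>.\<close>

lemma lacunary_newton:
  fixes e s :: "nat \<Rightarrow> 'a::idom" and p N J :: nat
  assumes p: "prime p" "CHAR('a) = p" and N: "N mod p = 1" and J: "J < N"
    and e0: "e 0 = 1"
    and newton: "\<And>k. of_nat k * e k = - (\<Sum>i<k. e i * s (k - i))"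
    and lac: "\<And>i. 0 < i \<Longrightarrow> i \<le> (p - 1) * N + J \<Longrightarrow> s i \<noteq> 0 \<Longrightarrow>
      (i mod p \<ge> 1 \<and> i = (i mod p) * N) \<or> i > (i mod p) * N + J"
    and k: "k \<le> (p - 1) * N + J"
  shows "k < (k mod p) * N \<longrightarrow> e k = 0"
    and "(k mod p) * N \<le> k \<and> k \<le> (k mod p) * N + J \<longrightarrow>
      e k = e ((k mod p) * N) * e (k - (k mod p) * N) \<and>
      of_nat (k mod p) * e ((k mod p) * N) = - (\<Sum>\<rho>\<in>{1..k mod p}. e ((k mod p - \<rho>) * N) * s (\<rho> * N))"
proof -
  have "(k < (k mod p) * N \<longrightarrow> e k = 0) \<and> ((k mod p) * N \<le> k \<and> k \<le> (k mod p) * N + J \<longrightarrow>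
      e k = e ((k mod p) * N) * e (k - (k mod p) * N) \<and>
      of_nat (k mod p) * e ((k mod p) * N) = - (\<Sum>\<rho>\<in>{1..k mod p}. e ((k mod p - \<rho>) * N) * s (\<rho> * N)))"
    using k
  proof (induction k rule: less_induct)
    case (less k)
    define c where "c = k mod p"
    have p0: "p > 0" using p prime_gt_0_nat by blast
    have cp: "c < p" using p0 by (simp add: c_def)
    have vanish: "e i = 0" if "i < k" "i < (i mod p) * N" for i
      using less.IH[OF that(1)] less.prems that by simp
    have prod: "e i = e ((i mod p) * N) * e (i - (i mod p) * N)"
      if "i < k" "(i mod p) * N \<le> i" "i \<le> (i mod p) * N + J" for i
      using less.IH[OF that(1)] less.prems that by simp
    have modN: "(x * N) mod p = x mod p" for x
      using N by (metis mod_mult_right_eq mult.right_neutral)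
    have diff: "(l - r) mod p = c - r mod p" if "l mod p = c" "r \<le> l" "r mod p \<le> c" for l r
    proof -
      have "[(l - r) + r = (c - r mod p) + r mod p] (mod p)"
        using that cp by (simp add: unique_euclidean_semiring_class.cong_def)
      moreover have "[r = r mod p] (mod p)" by (simp add: unique_euclidean_semiring_class.cong_def)
      ultimately have "[(l - r) = (c - r mod p)] (mod p)"
        by (metis cong_add_lcancel_nat add.commute cong_add_rcancel_nat cong_trans cong_add cong_refl cong_sym)
      then show ?thesis using cp by (simp add: unique_euclidean_semiring_class.cong_def)
    qed
    have of_nat_k: "(of_nat l :: 'a) = of_nat c" if "l mod p = c" for l
      using that of_nat_mod_CHAR[of l, where 'a = 'a] p by simp
    have c_nz: "(of_nat c :: 'a) \<noteq> 0" if "c > 0"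
      using that cp p by (simp add: of_nat_eq_0_iff_char_dvd nat_dvd_not_less)
    show ?case
    proof (cases "c = 0")
      case True
      then show ?thesis by (simp add: c_def[symmetric] e0)
    next
      case c0: False
      have low: "e k = 0" if kc: "k < c * N"
      proof -
        have "e i * s (k - i) = 0" if i: "i < k" for i
        proof (cases "s (k - i) = 0")
          case False
          define r where "r = k - i"
          have "(r mod p \<ge> 1 \<and> r = (r mod p) * N) \<or> r > (r mod p) * N + J"
            using lac[of r] i less.prems False by (simp add: r_def)
          then have rN: "(r mod p) * N \<le> r" by auto
          also have "r < c * N" using kc by (simp add: r_def)
          finally have rc: "r mod p < c" by simp
          have i': "i = k - r" using i by (simp add: r_def)
          have im: "i mod p = c - r mod p"
            unfolding i' by (rule diff) (use rc in \<open>auto simp: c_def r_def\<close>)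
          have "i < (c - r mod p) * N"
            using rN kc i by (simp add: r_def diff_mult_distrib)
          then have "e i = 0" using vanish[OF i] im by simp
          then show ?thesis by simp
        qed simp
        then have "(\<Sum>i<k. e i * s (k - i)) = 0" by (intro sum.neutral) blast
        then have "of_nat k * e k = 0" using newton[of k] by simp
        then show ?thesis using of_nat_k[of k] c_nz c0 by (simp add: c_def)
      qed
      define D where "D = (\<Sum>\<rho>\<in>{1..c}. e ((c - \<rho>) * N) * s (\<rho> * N))"
      have N0: "N > 0" using J by simp
      \<comment> \<open>This is used for \<open>l = k\<close> and for \<open>l = c * N\<close>;
        eliminating the common \<open>D\<close> gives the product formula.\<close>
      have step: "of_nat c * e l = - (D * e (l - c * N))"
        if l: "l \<le> k" "l mod p = c" "c * N \<le> l" "l \<le> c * N + J" for l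
      proof -
        define t where "t = l - c * N"
        have lt: "l = c * N + t" "t \<le> J" using l by (auto simp: t_def)
        have tm: "t mod p = 0"
          using diff[of l "c * N"] l cp by (simp add: t_def modN)
        let ?f = "\<lambda>i. e i * s (l - i)"
        have inj: "inj_on (\<lambda>\<rho>. l - \<rho> * N) {1..c}"
        proof (rule inj_onI)
          fix x y assume xy: "x \<in> {1..c}" "y \<in> {1..c}" "l - x * N = l - y * N"
          then have "x * N \<le> c * N" "y * N \<le> c * N" by (auto intro: mult_le_mono1)
          then have "x * N = y * N" using xy l by linarith
          then show "x = y" using N0 by simp
        qed
        have "(\<Sum>i<l. ?f i) = (\<Sum>i\<in>(\<lambda>\<rho>. l - \<rho> * N) ` {1..c}. ?f i)"
        proof (rule sum.mono_neutral_right)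
          show "(\<lambda>\<rho>. l - \<rho> * N) ` {1..c} \<subseteq> {..<l}"
            using N0 c0 lt(1) by auto
          show "\<forall>i\<in>{..<l} - (\<lambda>\<rho>. l - \<rho> * N) ` {1..c}. ?f i = 0"
          proof
            fix i assume "i \<in> {..<l} - (\<lambda>\<rho>. l - \<rho> * N) ` {1..c}"
            then have i: "i < l" and ni: "i \<notin> (\<lambda>\<rho>. l - \<rho> * N) ` {1..c}" by auto
            show "?f i = 0"
            proof (cases "s (l - i) = 0")
              case False
              define r where "r = l - i"
              have i': "i = l - r" "r \<le> l" using i by (auto simp: r_def)
              have lr: "(r mod p \<ge> 1 \<and> r = (r mod p) * N) \<or> r > (r mod p) * N + J"
                using lac[of r] i less.prems False l by (simp add: r_def)
              then have rN: "(r mod p) * N \<le> r" by auto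
              also have "r \<le> c * N + J" using l i' by simp
              \<comment> \<open>Here \<open>J < N\<close> ensures that the residue of
                \<open>r\<close> does not exceed \<open>c\<close>, so residues subtract without
                wrapping around.\<close>
              also have "\<dots> < (c + 1) * N" using J by simp
              finally have rc: "r mod p \<le> c" by (simp only: mult_less_cancel2) simp
              have im: "i mod p = c - r mod p"
                unfolding i'(1) by (rule diff) (use rc l i' in auto)
              have "\<not> (r mod p \<ge> 1 \<and> r = (r mod p) * N)"
              proof
                assume "r mod p \<ge> 1 \<and> r = (r mod p) * N"
                then have "i = l - (r mod p) * N" "r mod p \<in> {1..c}" using i' rc by auto
                then show False using ni by blast
              qed
              then have "r > (r mod p) * N + J" using lr by blast
              then have "i + (r mod p) * N < c * N" using i' l by linarith
              then have "i < (c - r mod p) * N" by (simp add: diff_mult_distrib)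
              then have "e i = 0" using vanish[of i] i l im by simp
              then show ?thesis by simp
            qed simp
          qed
        qed simp
        also have "\<dots> = (\<Sum>\<rho>\<in>{1..c}. ?f (l - \<rho> * N))"
          by (rule sum.reindex[OF inj, unfolded o_def])
        also have "\<dots> = (\<Sum>\<rho>\<in>{1..c}. e ((c - \<rho>) * N) * s (\<rho> * N) * e t)"
        proof (rule sum.cong[OF refl])
          fix \<rho> assume \<rho>: "\<rho> \<in> {1..c}"
          have le: "\<rho> * N \<le> c * N" using \<rho> by simp
          have \<rho>p: "\<rho> mod p = \<rho>" using \<rho> cp by simp
          have i: "l - \<rho> * N = (c - \<rho>) * N + t"
            using le lt(1) by (simp add: diff_mult_distrib)
          have im: "(l - \<rho> * N) mod p = c - \<rho>"
            using diff[of l "\<rho> * N"] l le \<rho> by (simp add: modN \<rho>p)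
          have "\<rho> * N > 0" using \<rho> N0 by simp
          then have "l - \<rho> * N < k" using l c0 N0 lt(1) by (metis diff_less le_less_trans less_le_trans add_gr_0 mult_pos_pos neq0_conv not_le)
          then have "e (l - \<rho> * N) = e ((c - \<rho>) * N) * e t"
            using prod[of "l - \<rho> * N"] im i lt(2) by simp
          moreover have "l - (l - \<rho> * N) = \<rho> * N" using le lt(1) by linarith
          ultimately show "?f (l - \<rho> * N) = e ((c - \<rho>) * N) * s (\<rho> * N) * e t"
            by simp
        qed
        also have "\<dots> = D * e t" by (simp add: D_def sum_distrib_right)
        finally show ?thesis using newton[of l] of_nat_k[OF l(2)] by (simp add: t_def)
      qed
      have "e k = e (c * N) * e (k - c * N) \<and> of_nat c * e (c * N) = - D"
        if kc: "c * N \<le> k" "k \<le> c * N + J"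
      proof -
        have 1: "of_nat c * e k = - (D * e (k - c * N))"
          by (rule step) (use kc in \<open>auto simp: c_def\<close>)
        have 2: "of_nat c * e (c * N) = - D"
          using step[of "c * N"] kc cp by (simp add: modN e0)
        have "of_nat c * e k = of_nat c * (e (c * N) * e (k - c * N))"
          using 1 2 by (metis mult.assoc mult_minus_left)
        then show ?thesis using 2 c_nz c0 by simp
      qed
      then show ?thesis using low unfolding c_def[symmetric] D_def by blast
    qed
  qed
  then show "k < (k mod p) * N \<longrightarrow> e k = 0"
    and "(k mod p) * N \<le> k \<and> k \<le> (k mod p) * N + J \<longrightarrow>
      e k = e ((k mod p) * N) * e (k - (k mod p) * N) \<and>
      of_nat (k mod p) * e ((k mod p) * N) = - (\<Sum>\<rho>\<in>{1..k mod p}. e ((k mod p - \<rho>) * N) * s (\<rho> * N))"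
    by blast+
qed

section \<open>Moments of words of the dual code\<close>

text \<open>\<open>c\<close> takes natural values so that coordinates can serve as exponents,
  whereas \<open>line_sum\<close> states orthogonality to the lines inside the field of
  characteristic \<open>p\<close> in which the moments are computed.\<close>

locale affine_line_dual =
  fixes p h m :: nat and \<phi> :: "'k::{field,finite} ^ 'm::finite \<Rightarrow> 'k alg_closure"
    and c :: "'k ^ 'm \<Rightarrow> nat"
  assumes prime_p: "prime p" and p_gt_2: "p > 2" and card_k: "CARD('k) = p ^ h" and card_m: "CARD('m) = m" and char_k: "CHAR('k) = p"
    and phi_add: "\<phi> (x + y) = \<phi> x + \<phi> y" and phi_smult: "\<phi> (t *s x) = to_ac t * \<phi> x"
    and inj_phi: "inj \<phi>" and phi_fixed: "\<phi> x ^ ((p ^ h) ^ m) = \<phi> x"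
    and line_sum: "d \<noteq> 0 \<Longrightarrow> (\<Sum>t\<in>UNIV. of_nat (c (a + t *s d)) :: 'k alg_closure) = 0"
begin

abbreviation "q \<equiv> p ^ h"

lemma p_ge_2: "p \<ge> 2" using p_gt_2 by simp

lemma m_ge_1: "m \<ge> 1" using card_m by (simp add: Suc_le_eq flip: card_m)

lemma h_ge_1: "h \<ge> 1"
proof (rule ccontr)
  assume "\<not> h \<ge> 1"
  then have "CARD('k) = 1" using card_k by simp
  moreover have "2 \<le> CARD('k)" using card_mono[of "UNIV :: 'k set" "{0, 1}"] by simp
  ultimately show False by simp
qed

lemma q_ge_p: "q \<ge> p"
  using self_le_power[of p h] h_ge_1 p_gt_2 by simp

lemma prime_CHAR_ac: "prime CHAR('k alg_closure)" "p = CHAR('k alg_closure)"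
  using prime_p char_k by simp_all

lemma phi_0: "\<phi> 0 = 0"
  using phi_smult[of 0 0] by simp

lemma phi_diff: "\<phi> (x - y) = \<phi> x - \<phi> y"
  using phi_add[of "x - y" y] by (simp add: algebra_simps)

section \<open>Vanishing moments from vanishing line sums\<close>

text \<open>Every nonzero \<open>t\<close> satisfies \<open>t ^ w = 1\<close>, so the sum is
  \<open>q - 1\<close>, that is \<open>- 1\<close> in \<open>'k\<close>.\<close>

lemma sum_power_field:
  assumes "w > 0" "(q - 1) dvd w"
  shows "(\<Sum>t\<in>UNIV. t ^ w) \<noteq> (0 :: 'k)"
proof -
  obtain l where l: "w = (q - 1) * l" using assms by blast
  have "t ^ w = 1" if "t \<noteq> 0" for t :: 'k
  proof -
    have "t * t ^ (q - 1) = t ^ CARD('k)"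
      using card_k p_gt_2 by (simp flip: power_Suc)
    then have "t ^ (q - 1) = 1" using that by (simp add: field_power_CARD)
    then show ?thesis by (simp add: l power_mult)
  qed
  then have "(\<Sum>t\<in>UNIV. t ^ w :: 'k) = (\<Sum>t\<in>UNIV - {0 :: 'k}. 1)"
    using assms(1) by (intro sum.mono_neutral_cong_right) (auto simp: power_0_left)
  also have "\<dots> = of_nat (q - 1)" by (simp add: card_Diff_singleton card_k)
  also have "\<dots> = -1"
  proof -
    have "of_nat (q - 1) + 1 = (of_nat q :: 'k)"
      using p_gt_2 by (metis One_nat_def Suc_eq_plus1 Suc_pred gr0I less_nat_zero_code of_nat_1 of_nat_add power_eq_0_iff)
    also have "\<dots> = 0" using of_nat_CARD_field[where 'a = 'k] by (simp only: card_k)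
    finally show ?thesis by (simp add: eq_neg_iff_add_eq_0)
  qed
  finally show ?thesis by simp
qed

text \<open>Translation by \<open>t *s d\<close> turns the double sum into line sums in direction
  \<open>d\<close>, weighted by \<open>\<phi> a ^ n\<close>.\<close>

lemma line_moment:
  assumes "d \<noteq> 0"
  shows "(\<Sum>t\<in>UNIV. \<Sum>x\<in>UNIV. of_nat (c x) * (\<phi> x - to_ac t * \<phi> d) ^ n) = 0"
proof -
  have "(\<Sum>x\<in>UNIV. of_nat (c x) * (\<phi> x - to_ac t * \<phi> d) ^ n)
      = (\<Sum>a\<in>UNIV. of_nat (c (a + t *s d)) * \<phi> a ^ n)" for t
    by (rule sum.reindex_bij_witness[of _ "\<lambda>a. a + t *s d" "\<lambda>x. x - t *s d"])
      (simp_all add: phi_diff phi_smult)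
  then have "(\<Sum>t\<in>UNIV. \<Sum>x\<in>UNIV. of_nat (c x) * (\<phi> x - to_ac t * \<phi> d) ^ n)
      = (\<Sum>a\<in>UNIV. (\<Sum>t\<in>UNIV. of_nat (c (a + t *s d))) * \<phi> a ^ n)"
    by (simp only: sum_distrib_right) (rule sum.swap)
  then show ?thesis by (simp add: line_sum[OF assms])
qed

text \<open>The complement \<open>u\<close> of \<open>\<epsilon>\<close> has all weighted digit sums
  at least \<open>q - 1\<close>, so its sub-digits form some \<open>w > 0\<close> divisible by
  \<open>q - 1\<close>. In the expansion of the line moments of order
  \<open>n = \<epsilon> + w\<close>, the term for \<open>w\<close> has nonzero binomial coefficient
  and nonzero power sum over \<open>'k\<close>, which isolates the moment of order
  \<open>\<epsilon>\<close>.\<close>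

lemma moment_eq_0:
  assumes eps: "\<epsilon> < q ^ m" and wt: "\<And>j. digit_wt p h j \<epsilon> \<le> (m - 1) * (q - 1)"
  shows "(\<Sum>x\<in>UNIV. of_nat (c x) * \<phi> x ^ \<epsilon>) = 0"
proof -
  define u where "u = q ^ m - 1 - \<epsilon>"
  have qm: "q ^ m = p ^ (m * h)" by (simp add: power_mult[symmetric] mult.commute)
  have u: "u < p ^ (m * h)" using eps by (simp add: u_def qm)
  have "digit_wt p h j u \<ge> q - 1" for j
  proof -
    have "digit_wt p h j \<epsilon> + digit_wt p h j u = m * (q - 1)"
      using eps by (simp only: u_def qm digit_wt_compl[OF p_ge_2] digit_wt_full[OF p_ge_2 h_ge_1])
    moreover have "m * (q - 1) = (m - 1) * (q - 1) + (q - 1)" using m_ge_1 by (cases m) auto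
    ultimately show ?thesis using wt[of j] by linarith
  qed
  from exists_subdigits_dvd[OF p_ge_2 h_ge_1 u this]
  obtain d where d: "\<And>i. i < m * h \<Longrightarrow> d i \<le> u div p ^ i mod p"
    and pos: "(\<Sum>i<m * h. d i * p ^ i) > 0" and dvd: "(q - 1) dvd (\<Sum>i<m * h. d i * p ^ i)"
    by blast
  define w where "w = (\<Sum>i<m * h. d i * p ^ i)"
  define n where "n = \<epsilon> + w"
  have "w \<le> (\<Sum>i<m * h. (u div p ^ i mod p) * p ^ i)"
    unfolding w_def by (intro sum_mono mult_le_mono1) (use d in auto)
  also have "\<dots> = u" using p_ge_2 u by (intro sum_digits) auto
  finally have n: "n < q ^ m" using eps by (simp add: n_def u_def)
  have "u + \<epsilon> = p ^ (m * h) - 1" using eps by (simp add: u_def qm)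
  from of_nat_binomial_add_nonzero[OF prime_CHAR_ac this d]
  have bin: "(of_nat (n choose w) :: 'k alg_closure) \<noteq> 0"
    by (simp add: n_def w_def)
  define P where "P = (\<lambda>r. \<Sum>x\<in>UNIV. of_nat (c x) * \<phi> x ^ r)"
  define T where "T = (\<lambda>v. to_ac (\<Sum>t\<in>UNIV. t ^ v :: 'k))"
  \<comment> \<open>Summing \<open>\<phi> ^ n\<close> against the line sums in direction \<open>d\<close> gives \<open>poly G (\<phi> d) = 0\<close>, for more directions than \<open>degree G\<close>.\<close>
  define G where "G = (\<Sum>v\<le>n. monom (of_nat (n choose v) * (- 1) ^ v * T v * P (n - v)) v)"
  have degG: "degree G \<le> n"
    unfolding G_def by (intro degree_sum_le) (auto intro: order.trans[OF degree_monom_le])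
  have root: "poly G (\<phi> d) = 0" for d
  proof (cases "d = 0")
    case True
    \<comment> \<open>At \<open>\<phi> 0 = 0\<close> only the constant coefficient of
      \<open>G\<close> counts. It contains \<open>T 0\<close>, which is \<open>q = 0\<close> because
      \<open>t ^ 0 = 1\<close> also for \<open>t = 0\<close>.\<close>
    have "T 0 = 0" using of_nat_CARD_field[where 'a = 'k] by (simp add: T_def)
    then show ?thesis
      by (simp add: True phi_0 G_def poly_sum poly_monom power_0_left if_distrib cong: if_cong)
  next
    case False
    have "(\<phi> x - to_ac t * \<phi> d) ^ n
        = (\<Sum>v\<le>n. of_nat (n choose v) * (- 1) ^ v * \<phi> d ^ v * to_ac (t ^ v) * \<phi> x ^ (n - v))" for x t
    proof -
      have "(- (to_ac t * \<phi> d) + \<phi> x) ^ n = (\<Sum>v\<le>n. of_nat (n choose v) * (- (to_ac t * \<phi> d)) ^ v * \<phi> x ^ (n - v))"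
        by (rule binomial_ring)
      also have "\<dots> = (\<Sum>v\<le>n. of_nat (n choose v) * (- 1) ^ v * \<phi> d ^ v * to_ac (t ^ v) * \<phi> x ^ (n - v))"
        by (intro sum.cong refl) (subst power_minus, simp add: power_mult_distrib mult_ac)
      finally show ?thesis by simp
    qed
    then have "0 = (\<Sum>t\<in>UNIV. \<Sum>x\<in>UNIV. of_nat (c x) *
        (\<Sum>v\<le>n. of_nat (n choose v) * (- 1) ^ v * \<phi> d ^ v * to_ac (t ^ v) * \<phi> x ^ (n - v)))"
      using line_moment[OF False, of n] by simp
    also have "\<dots> = (\<Sum>t\<in>UNIV. \<Sum>v\<le>n. \<Sum>x\<in>UNIV.
        of_nat (n choose v) * (- 1) ^ v * \<phi> d ^ v * to_ac (t ^ v) * (of_nat (c x) * \<phi> x ^ (n - v)))"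
      by (intro sum.cong refl, subst sum.swap) (simp add: sum_distrib_left mult_ac)
    also have "\<dots> = (\<Sum>t\<in>UNIV. \<Sum>v\<le>n. of_nat (n choose v) * (- 1) ^ v * \<phi> d ^ v * to_ac (t ^ v) * P (n - v))"
      by (simp only: P_def sum_distrib_left)
    also have "\<dots> = (\<Sum>v\<le>n. \<Sum>t\<in>UNIV. of_nat (n choose v) * (- 1) ^ v * \<phi> d ^ v * to_ac (t ^ v) * P (n - v))"
      by (rule sum.swap)
    also have "\<dots> = (\<Sum>v\<le>n. of_nat (n choose v) * (- 1) ^ v * \<phi> d ^ v * T v * P (n - v))"
      by (simp only: T_def to_ac_sum sum_distrib_left sum_distrib_right)
    also have "\<dots> = poly G (\<phi> d)"
      by (simp add: G_def poly_sum poly_monom mult_ac)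
    finally show ?thesis by simp
  qed
  have "G = 0"
  proof (rule ccontr)
    assume G: "G \<noteq> 0"
    have "q ^ m = card (range \<phi>)" by (simp add: card_image[OF inj_phi] card_k card_m)
    also have "\<dots> \<le> card {z. poly G z = 0}"
      using root by (intro card_mono poly_roots_finite G) auto
    also have "\<dots> \<le> n" using card_poly_roots_bound[OF G] degG by simp
    finally show False using n by simp
  qed
  then have "coeff G w = 0" by simp
  moreover have "coeff G w = of_nat (n choose w) * (- 1) ^ w * T w * P (n - w)"
    by (simp add: G_def coeff_sum n_def)
  moreover have "T w \<noteq> 0"
    using sum_power_field[of w] pos dvd by (simp only: T_def w_def to_ac_eq_0_iff not_False_eq_True)
  ultimately have "P (n - w) = 0" using bin by simp
  then show ?thesis by (simp add: P_def n_def)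
qed

text \<open>Larger exponents are lowered by \<open>q ^ m - 1\<close>, using
  \<open>\<phi> x ^ (q ^ m) = \<phi> x\<close>; by \<open>digit_wt_Suc_le\<close> this never
  increases the weighted digit sum. The bound \<open>p * q ^ m\<close> keeps the part above
  \<open>q ^ m\<close> a single digit.\<close>

lemma moment_nonzero_imp:
  assumes "\<epsilon> < p * q ^ m" and "(\<Sum>x\<in>UNIV. of_nat (c x) * \<phi> x ^ \<epsilon>) \<noteq> 0"
  shows "\<exists>j. digit_wt p h j \<epsilon> > (m - 1) * (q - 1)"
  using assms
proof (induction \<epsilon> rule: less_induct)
  case (less \<epsilon>)
  show ?case
  proof (cases "\<epsilon> < q ^ m")
    case True
    then show ?thesis using moment_eq_0[of \<epsilon>] less.prems(2) by (meson not_le)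
  next
    case False
    define \<delta> where "\<delta> = \<epsilon> - q ^ m"
    have \<epsilon>: "\<epsilon> = \<delta> + q ^ m" using False by (simp add: \<delta>_def)
    have q2: "q \<ge> 2" using q_ge_p p_gt_2 by simp
    have "q ^ 1 \<le> q ^ m" using q2 m_ge_1 by (intro power_increasing) auto
    then have qm2: "q ^ m \<ge> 2" using q2 by simp
    have "\<phi> x ^ \<epsilon> = \<phi> x ^ Suc \<delta>" for x
      using phi_fixed[of x] by (simp add: \<epsilon> power_add)
    then have "(\<Sum>x\<in>UNIV. of_nat (c x) * \<phi> x ^ Suc \<delta>) \<noteq> 0" using less.prems(2) by simp
    moreover have "Suc \<delta> < \<epsilon>" using qm2 by (simp add: \<epsilon>)
    ultimately obtain j where j: "digit_wt p h j (Suc \<delta>) > (m - 1) * (q - 1)"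
      using less.IH[of "Suc \<delta>"] less.prems(1) by auto
    define t where "t = \<delta> div q ^ m"
    have qm: "q ^ m = p ^ (m * h)" by (simp add: power_mult[symmetric] mult.commute)
    have "\<delta> + q ^ m < p * q ^ m" using less.prems(1) \<epsilon> by simp
    then have "(\<delta> + q ^ m) div q ^ m < p" by (rule less_mult_imp_div_less)
    moreover have divt: "(\<delta> + q ^ m) div q ^ m = Suc t" using p_gt_2 by (subst div_add_self2) (auto simp: t_def)
    ultimately have t: "Suc t < p" by simp
    have "digit_wt p h j \<epsilon> = digit_wt p h j (\<delta> mod q ^ m) + digit_wt p h (j + m * h) (Suc t)"
      using digit_wt_split[OF p_ge_2, of h j \<epsilon> "m * h"] divt by (simp add: \<epsilon> qm)
    also have "\<dots> = digit_wt p h j (\<delta> mod q ^ m) + digit_wt p h (j + m * h) t + p ^ (j mod h)"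
      using digit_wt_digit[OF p_ge_2 t] digit_wt_digit[OF p_ge_2 Suc_lessD[OF t]] by simp
    also have "\<dots> = digit_wt p h j \<delta> + p ^ (j mod h)"
      using digit_wt_split[OF p_ge_2, of h j \<delta> "m * h"] by (simp add: qm t_def)
    also have "\<dots> \<ge> digit_wt p h j (Suc \<delta>)" by (rule digit_wt_Suc_le[OF p_ge_2])
    finally show ?thesis using j by (intro exI[of _ j]) simp
  qed
qed

text \<open>A nonzero coefficient gives a nonzero moment of some order \<open>e - r\<close> with
  \<open>e choose (e - r)\<close> nonzero, so the weighted digit sum of \<open>e\<close> exceeds
  \<open>(m - 1) * (q - 1)\<close>. Being a multiple of \<open>q - 1\<close>, it reaches
  \<open>m * (q - 1)\<close>.\<close>

lemma linear_form_moment_imp: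
  assumes e: "e < p * q ^ m" "(q - 1) dvd e" and nz: "(\<Sum>x\<in>UNIV. of_nat (c x) * [:\<phi> x, 1:] ^ e) \<noteq> 0"
  shows "\<exists>j. digit_wt p h j e \<ge> m * (q - 1)"
proof -
  obtain r where r: "coeff (\<Sum>x\<in>UNIV. of_nat (c x) * [:\<phi> x, 1:] ^ e) r \<noteq> 0"
    using nz by (auto simp: poly_eq_iff)
  have cf: "coeff (of_nat (c x) * [:\<phi> x, 1:] ^ e) r = of_nat (c x) * coeff ([:\<phi> x, 1:] ^ e) r" for x
    by (simp add: of_nat_poly)
  have re: "r \<le> e"
  proof (rule ccontr)
    assume "\<not> r \<le> e"
    then have "coeff ([:\<phi> x, 1:] ^ e) r = 0" for x
      by (intro coeff_eq_0) (simp add: degree_power_eq)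
    then show False using r by (simp add: coeff_sum cf)
  qed
  have "coeff (\<Sum>x\<in>UNIV. of_nat (c x) * [:\<phi> x, 1:] ^ e) r
      = of_nat (e choose (e - r)) * (\<Sum>x\<in>UNIV. of_nat (c x) * \<phi> x ^ (e - r))"
    using re binomial_symmetric[OF re]
    by (simp add: coeff_sum cf coeff_linear_poly_power sum_distrib_left mult_ac)
  then have bin: "(of_nat (e choose (e - r)) :: 'k alg_closure) \<noteq> 0"
    and mom: "(\<Sum>x\<in>UNIV. of_nat (c x) * \<phi> x ^ (e - r)) \<noteq> 0"
    using r by auto
  have "e - r < p * q ^ m" using e(1) by (rule less_imp_diff_less)
  from moment_nonzero_imp[OF this mom]
  obtain j where "digit_wt p h j (e - r) > (m - 1) * (q - 1)" by blast
  also have "digit_wt p h j (e - r) \<le> digit_wt p h j e"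
    by (rule digit_wt_le_of_binomial[OF prime_CHAR_ac bin])
  finally have gt: "digit_wt p h j e > (m - 1) * (q - 1)" .
  obtain l where l: "digit_wt p h j e = (q - 1) * l"
    using dvd_digit_wt[OF p_ge_2 h_ge_1 e(2)] by blast
  have "(m - 1) * (q - 1) < l * (q - 1)" using gt unfolding l by (simp only: mult.commute)
  then have "m - 1 < l" by simp
  then have "m * (q - 1) \<le> l * (q - 1)" by (intro mult_le_mono1) simp
  then show ?thesis using l by (intro exI[of _ j]) (simp only: mult.commute)
qed

section \<open>The lower bound for the sum of the multiplicities\<close>

lemma sum_multiplicities_ge:
  assumes x0: "c x0 = 1" and m: "m \<ge> 2"
  shows "(\<Sum>x\<in>UNIV. c x) \<ge> (p - 1) * q ^ (m - 1) + p * q ^ (m - 2)"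
proof -
  define \<sigma> where "\<sigma> = (\<Sum>x\<in>UNIV. c x)"
  define N where "N = (\<Sum>i<m. q ^ i)"
  define L where "L = (\<lambda>x. [:\<phi> x, 1:])"
  define F where "F = (\<Prod>x\<in>UNIV. [:1, - (L x ^ (q - 1)):] ^ c x)"
  define e where "e = coeff F"
  define s where "s = (\<lambda>i. \<Sum>x\<in>UNIV. of_nat (c x) * (L x ^ (q - 1)) ^ i)"
  have q3: "q \<ge> 3" using q_ge_p p_gt_2 by simp
  have pq: "p dvd q" using h_ge_1 by (simp add: dvd_power)
  have N: "N * (q - 1) = q ^ m - 1"
  proof -
    have "(\<Sum>i<l. q ^ i) * (q - 1) + 1 = q ^ l" for l
    proof (induction l)
      case (Suc l)
      have "(\<Sum>i<Suc l. q ^ i) * (q - 1) + 1 = q ^ l + q ^ l * (q - 1)"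
        using Suc by (simp add: add_mult_distrib)
      also have "\<dots> = q ^ l * (1 + (q - 1))" by (simp only: distrib_left mult_1_right)
      also have "1 + (q - 1) = q" using q3 by simp
      also have "q ^ l * q = q ^ Suc l" by (rule power_Suc2[symmetric])
      finally show ?case .
    qed simp
    then show ?thesis unfolding N_def by (metis diff_add_inverse2)
  qed
  \<comment> \<open>Only the two largest terms \<open>q ^ (m - 1)\<close> and
    \<open>q ^ (m - 2)\<close> of \<open>N\<close> are kept.\<close>
  have N_ge: "N \<ge> (q + 1) * q ^ (m - 2)"
  proof -
    obtain l where l: "m = Suc (Suc l)" using m by (metis Suc_le_D numeral_2_eq_2 Suc_le_mono)
    show ?thesis by (simp add: N_def l)
  qed
  have N_mod: "N mod p = 1"
  proof -
    obtain l where l: "m = Suc l" using m by (cases m) auto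
    have "N = 1 + q * (\<Sum>i<l. q ^ i)"
      unfolding N_def l by (subst sum.lessThan_Suc_shift) (simp add: sum_distrib_left)
    moreover have "q * (\<Sum>i<l. q ^ i) mod p = 0" using pq by (simp add: mod_eq_0_iff_dvd)
    ultimately have "N mod p = 1 mod p" by (metis mod_add_right_eq add.right_neutral)
    then show ?thesis using p_gt_2 by simp
  qed
  have N0: "N > 0" using N_mod by (cases "N = 0") auto
  have modN: "(l * N) mod p = l mod p" for l
    using N_mod by (metis mod_mult_right_eq mult.right_neutral)
  have sum0: "(\<Sum>x\<in>UNIV. of_nat (c x)) = (0 :: 'k alg_closure)"
    using moment_eq_0[of 0] p_gt_2 by simp
  have p_dvd: "p dvd \<sigma>"
  proof -
    have "(of_nat \<sigma> :: 'k alg_closure) = 0" using sum0 by (simp add: \<sigma>_def)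
    then show ?thesis by (simp add: of_nat_eq_0_iff_char_dvd char_k)
  qed
  have degF: "degree F \<le> \<sigma>" unfolding F_def \<sigma>_def by (rule degree_prod_linear_le) simp
  have e0: "e 0 = 1"
    by (simp add: e_def F_def poly_prod flip: poly_0_coeff_0)
  have newton: "of_nat k * e k = - (\<Sum>i<k. e i * s (k - i))" for k
    unfolding e_def F_def s_def by (rule newton_identity) simp
  \<comment> \<open>\<open>J\<close> is left general because the gap is used with
    \<open>J = 0\<close> in \<open>e_val\<close> and with \<open>J = q ^ (m - 2)\<close> at the
    end.\<close>
  have lac: "(i mod p \<ge> 1 \<and> i = (i mod p) * N) \<or> i > (i mod p) * N + J"
    if J: "J * (q - 1) \<le> q ^ (m - 1)" and i: "0 < i" "i \<le> (p - 1) * N + J" and nz: "s i \<noteq> 0" for i J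
  proof -
    have s: "s i = (\<Sum>x\<in>UNIV. of_nat (c x) * [:\<phi> x, 1:] ^ (i * (q - 1)))"
      by (simp only: s_def L_def power_mult[symmetric] mult.commute)
    have "i * (q - 1) \<le> ((p - 1) * N + J) * (q - 1)" using i(2) by (rule mult_le_mono1)
    also have "\<dots> = (p - 1) * (N * (q - 1)) + J * (q - 1)" by (simp add: add_mult_distrib)
    also have "\<dots> < p * q ^ m"
    proof -
      have "q ^ (m - 1) < q ^ m" using q3 m by (intro power_strict_increasing) auto
      moreover have "(p - 1) * (N * (q - 1)) \<le> (p - 1) * q ^ m" unfolding N by (intro mult_le_mono2) simp
      moreover have "p * q ^ m = (p - 1) * q ^ m + q ^ m"
        using p_gt_2 by (cases p) auto
      ultimately show ?thesis using J by linarith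
    qed
    finally have small: "i * (q - 1) < p * q ^ m" .
    obtain j where "digit_wt p h j (i * (q - 1)) \<ge> m * (q - 1)"
      using linear_form_moment_imp[OF small _ nz[unfolded s]] by auto
    then show ?thesis
      by (intro digit_wt_ge_imp_lacunary[OF p_gt_2 h_ge_1 m_ge_1 N J small])
  qed
  have CHARpoly: "CHAR('k alg_closure poly) = p" using char_k by simp
  \<comment> \<open>At \<open>X = - \<phi> x0\<close> the form \<open>L x\<close> becomes
    \<open>\<phi> (x - x0)\<close>. Its power with exponent \<open>(q ^ m - 1) * \<rho>\<close> is
    \<open>1\<close>, except for \<open>0\<close> at \<open>x = x0\<close>; so the result is the
    total \<open>0\<close> minus \<open>c x0 = 1\<close>.\<close>
  have s_val: "poly (s (\<rho> * N)) (- \<phi> x0) = -1" if "\<rho> \<ge> 1" for \<rho>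
  proof -
    have "poly (s (\<rho> * N)) (- \<phi> x0) = (\<Sum>x\<in>UNIV. of_nat (c x) * (\<phi> (x - x0) ^ (q - 1)) ^ (\<rho> * N))"
      by (simp add: s_def L_def poly_sum phi_diff)
    also have "\<dots> = (\<Sum>x\<in>UNIV. of_nat (c x) - (if x = x0 then 1 else 0))"
    proof (rule sum.cong[OF refl])
      fix x
      show "of_nat (c x) * (\<phi> (x - x0) ^ (q - 1)) ^ (\<rho> * N) = of_nat (c x) - (if x = x0 then 1 else 0)"
      proof (cases "x = x0")
        case True
        then show ?thesis using q3 N0 that x0 by (simp add: phi_0 power_0_left)
      next
        case False
        define z where "z = \<phi> (x - x0)"
        have "z \<noteq> 0" using False inj_phi phi_0 unfolding z_def
          by (metis injD eq_iff_diff_eq_0)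
        have "z ^ q ^ m = z" unfolding z_def by (rule phi_fixed)
        moreover have "Suc (q ^ m - 1) = q ^ m" using p_gt_2 by simp
        ultimately have "z * z ^ (q ^ m - 1) = z" by (metis power_Suc)
        moreover note \<open>z \<noteq> 0\<close>
        ultimately have "z ^ (q ^ m - 1) = 1" by simp
        moreover have "(q - 1) * (\<rho> * N) = (q ^ m - 1) * \<rho>"
          by (simp only: N[symmetric] ac_simps)
        then have "(z ^ (q - 1)) ^ (\<rho> * N) = (z ^ (q ^ m - 1)) ^ \<rho>"
          by (metis power_mult)
        ultimately show ?thesis using False by (simp add: z_def)
      qed
    qed
    also have "\<dots> = -1" using sum0 by (simp add: sum_subtractf)
    finally show ?thesis .
  qed
  \<comment> \<open>All \<open>s\<close> values are \<open>- 1\<close> and the earlier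
    \<open>e\<close> values are \<open>1\<close>, so Newton's identity reads
    \<open>l * e (l * N) = l\<close> at this point, with \<open>l\<close> nonzero modulo
    \<open>p\<close> for \<open>0 < l < p\<close>.\<close>
  have e_val: "poly (e (l * N)) (- \<phi> x0) = 1" if "l < p" for l
    using that
  proof (induction l rule: less_induct)
    case (less l)
    show ?case
    proof (cases "l = 0")
      case True
      then show ?thesis by (simp add: e0)
    next
      case False
      have lp: "l mod p = l" using less.prems by simp
      have "l \<le> p - 1" using less.prems by linarith
      then have kl: "l * N \<le> (p - 1) * N + 0" by simp
      have "of_nat l * e (l * N) = - (\<Sum>\<rho>\<in>{1..l}. e ((l - \<rho>) * N) * s (\<rho> * N))"
        using lacunary_newton(2)[OF prime_p CHARpoly N_mod N0 e0 newton lac kl] 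
        by (simp add: modN lp)
      then have "poly (of_nat l * e (l * N)) (- \<phi> x0)
          = poly (- (\<Sum>\<rho>\<in>{1..l}. e ((l - \<rho>) * N) * s (\<rho> * N))) (- \<phi> x0)" by (simp only:)
      also have "\<dots> = - (\<Sum>\<rho>\<in>{1..l}. poly (e ((l - \<rho>) * N)) (- \<phi> x0) * poly (s (\<rho> * N)) (- \<phi> x0))"
        by (simp add: poly_sum)
      also have "\<dots> = - (\<Sum>\<rho>\<in>{1..l}. 1 * -1)"
        by (intro arg_cong[of _ _ uminus] sum.cong refl arg_cong2[of _ _ _ _ "(*)"])
          (use less in \<open>auto intro!: s_val\<close>)
      also have "\<dots> = of_nat l" by simp
      finally have "of_nat l * poly (e (l * N)) (- \<phi> x0) = of_nat l" by simp
      moreover have "(of_nat l :: 'k alg_closure) \<noteq> 0"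
        using False less.prems char_k by (simp add: of_nat_eq_0_iff_char_dvd nat_dvd_not_less)
      ultimately show ?thesis by simp
    qed
  qed
  have top: "e ((p - 1) * N) \<noteq> 0" using e_val[of "p - 1"] p_gt_2 by auto
  then have ge: "(p - 1) * N \<le> \<sigma>" using degF le_degree[of F "(p - 1) * N"] unfolding e_def by simp
  have not_dvd: "\<not> p dvd (p - 1) * (q + 1)"
  proof
    assume "p dvd (p - 1) * (q + 1)"
    then have "p dvd p - 1 \<or> p dvd q + 1"
      by (simp only: prime_dvd_mult_iff[OF prime_p])
    moreover have "\<not> p dvd p - 1" using p_gt_2 by (intro nat_dvd_not_less) auto
    moreover have "\<not> p dvd q + 1" using p_gt_2 dvd_add_right_iff[OF pq, of 1] by simp
    ultimately show False by simp
  qed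
  have qm1: "q ^ (m - 1) = q * q ^ (m - 2)"
    using m by (metis Suc_diff_Suc Suc_1 less_eq_Suc_le power_Suc)
  \<comment> \<open>This form exhibits the quotient \<open>(p - 1) * (q + 1)\<close> that
    \<open>\<sigma>\<close> would have on division by \<open>q ^ (m - 2)\<close> if the bound
    failed.\<close>
  have bound: "(p - 1) * q ^ (m - 1) + p * q ^ (m - 2) = ((p - 1) * (q + 1) + 1) * q ^ (m - 2)"
  proof -
    obtain p' where "p = Suc p'" using p_gt_2 by (cases p) auto
    then show ?thesis unfolding qm1 by (simp add: algebra_simps)
  qed
  have "((p - 1) * (q + 1) + 1) * q ^ (m - 2) \<le> \<sigma>"
  proof (rule ccontr)
    assume less: "\<not> ?thesis"
    have ge': "(p - 1) * (q + 1) * q ^ (m - 2) \<le> (p - 1) * N"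
      using mult_le_mono2[OF N_ge, of "p - 1"] by (simp only: mult.assoc)
    show False
    proof (cases "m = 2")
      case True
      \<comment> \<open>As \<open>q ^ (m - 2) = 1\<close>, the lower and upper bounds leave a single
        value.\<close>
      then have "\<sigma> = (p - 1) * (q + 1)" using less ge ge' by simp
      then show False using p_dvd not_dvd by simp
    next
      case False
      define J where "J = q ^ (m - 2)"
      define k where "k = (p - 1) * N + J"
      have J: "J * (q - 1) \<le> q ^ (m - 1)"
      proof -
        have "J * (q - 1) \<le> J * q" by simp
        also have "\<dots> = q ^ (m - 1)" by (simp only: J_def qm1 mult.commute)
        finally show ?thesis .
      qed
      have J0: "J > 0" using p_gt_2 by (simp add: J_def)
      have JN: "J < N"
      proof -
        have "1 * J < (q + 1) * J" using J0 q3 p_gt_2 by (intro mult_strict_right_mono) auto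
        then show ?thesis using N_ge unfolding J_def[symmetric] by linarith
      qed
      \<comment> \<open>For \<open>m > 2\<close>, divisibility of \<open>J\<close> by
        \<open>p\<close> gives \<open>k\<close> the residue \<open>p - 1\<close>, so the product
        formula at \<open>k\<close> has \<open>e ((p - 1) * N)\<close> as a factor.\<close>
      have "q dvd J" unfolding J_def by (rule dvd_power) (use False m in auto)
      with pq have "p dvd J" by (rule dvd_trans)
      then have "k mod p = ((p - 1) * N) mod p" by (auto simp: k_def)
      then have kp: "k mod p = p - 1" using p_gt_2 by (simp add: modN)
      have kle: "k \<le> (p - 1) * N + J" by (simp add: k_def)
      have "e k = e ((p - 1) * N) * e J"
        using lacunary_newton(2)[OF prime_p CHARpoly N_mod JN e0 newton lac[OF J] kle]
        unfolding kp by (simp add: k_def)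
      moreover have "e k = 0"
      proof -
        have "((p - 1) * (q + 1) + 1) * J = (p - 1) * (q + 1) * J + J" by (simp only: add_mult_distrib mult_1)
        then have "\<sigma> < k" using less ge' unfolding k_def J_def[symmetric] by linarith
        then show ?thesis unfolding e_def using degF by (intro coeff_eq_0) simp
      qed
      moreover have "e J \<noteq> 0"
      proof -
        have "\<sigma> div J = (p - 1) * (q + 1)"
        proof (rule div_nat_eqI)
          show "J * ((p - 1) * (q + 1)) \<le> \<sigma>"
            using ge ge' unfolding J_def[symmetric] mult.commute[of J] by linarith
          show "\<sigma> < J * Suc ((p - 1) * (q + 1))"
            using less unfolding J_def[symmetric] mult.commute[of J] by simp
        qed
        moreover have "J = p ^ (h * (m - 2))" by (simp add: J_def power_mult)
        ultimately have "(of_nat (\<sigma> choose J) :: 'k alg_closure) = of_nat ((p - 1) * (q + 1))"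
          using of_nat_binomial_prime_power[OF prime_CHAR_ac, of \<sigma> "h * (m - 2)"] by simp
        then have "(of_nat (\<sigma> choose J) :: 'k alg_closure) \<noteq> 0"
          using not_dvd by (simp only: of_nat_eq_0_iff_char_dvd CHAR_alg_closure char_k not_False_eq_True)
        moreover have "coeff (e J) ((q - 1) * J) = (- 1) ^ J * of_nat (\<sigma> choose J)"
          unfolding e_def F_def \<sigma>_def
          by (rule coeff_prod_linear_monic) (auto simp: L_def degree_power_eq coeff_linear_power)
        ultimately show ?thesis by auto
      qed
      ultimately show False using top by simp
    qed
  qed
  then show ?thesis unfolding bound \<sigma>_def .
qed

end

theorem theorem1p2:
  fixes s :: "('p::prime_card) mod_ring ^ ('k::{field,finite} ^ 'm::finite)"
    and p q h m :: nat
  assumes "CARD('p) = p" and "CARD('k) = q" and "CARD('m) = m"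
    and "prime p" and "p > 2"
    and "q = p ^ h" and "q > p"
    and "m \<ge> 2"
    and "s \<in> dual_code AG_code"
    and "\<exists>x. s $ x = 1"
  shows "coord_sum s \<ge> (int p - 1) * int q ^ (m - 1) + int p * int q ^ (m - 2)"
proof -
  have char_k: "CHAR('k) = p"
  proof -
    have "prime CHAR('k)" by (intro prime_CHAR_semidom finite_imp_CHAR_pos) simp
    moreover have "CHAR('k) dvd p ^ h" using CHAR_dvd_CARD[where 'a = 'k] assms by simp
    ultimately show ?thesis using assms(4) by (meson prime_dvd_power primes_dvd_imp_eq)
  qed
  obtain \<phi> :: "'k ^ 'm \<Rightarrow> 'k alg_closure" where \<phi>: "\<And>x y. \<phi> (x + y) = \<phi> x + \<phi> y"
    "\<And>t x. \<phi> (t *s x) = to_ac t * \<phi> x" "inj \<phi>" "\<And>x. \<phi> x ^ (CARD('k) ^ CARD('m)) = \<phi> x"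
    using exists_linear_embedding_alg_closure[of p h, where 'k = 'k and 'm = 'm] assms char_k by auto
  define c where "c = (\<lambda>x. nat (to_int_mod_ring (s $ x)))"
  have int_c: "int (c x) = to_int_mod_ring (s $ x)" for x
    using range_to_int_mod_ring[where 'a = 'p] by (auto simp: c_def)
  have of_c: "(of_nat (c x) :: 'p mod_ring) = s $ x" for x
    by (metis int_c of_int_of_int_mod_ring of_int_of_nat_eq of_int_mod_ring_to_int_mod_ring)
  interpret affine_line_dual p h m \<phi> c
  proof
    fix d a :: "'k ^ 'm" assume d: "d \<noteq> 0"
    have inj: "inj (\<lambda>t. a + t *s d)"
    proof (rule injI)
      fix t u assume "a + t *s d = a + u *s d"
      then have "(t - u) *s d = 0" by (simp add: vector_sub_rdistrib)
      then show "t = u" using d by simp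
    qed
    have "range (\<lambda>t. a + t *s d) \<in> affine_lines" using d by (auto simp: affine_lines_def)
    then have "(\<Sum>x\<in>range (\<lambda>t. a + t *s d). s $ x) = 0"
      using assms(9) by (simp add: mem_dual_AG_code_iff)
    then have "(of_nat (\<Sum>t\<in>UNIV. c (a + t *s d)) :: 'p mod_ring) = 0"
      by (simp add: sum.reindex[OF inj] of_c)
    \<comment> \<open>Divisibility by \<open>p\<close> transfers the vanishing of the line sum from
      \<open>'p mod_ring\<close> to the closure of \<open>'k\<close>, both of characteristic
      \<open>p\<close>.\<close>
    then have "p dvd (\<Sum>t\<in>UNIV. c (a + t *s d))"
      by (simp only: of_nat_eq_0_iff_char_dvd semiring_char_mod_ring assms(1))
    then have "(of_nat (\<Sum>t\<in>UNIV. c (a + t *s d)) :: 'k alg_closure) = 0"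
      by (simp only: of_nat_eq_0_iff_char_dvd CHAR_alg_closure char_k)
    then show "(\<Sum>t\<in>UNIV. of_nat (c (a + t *s d)) :: 'k alg_closure) = 0" by simp
  qed (use assms char_k \<phi> in auto)
  obtain x0 where "s $ x0 = 1" using assms(10) by blast
  then have "c x0 = 1" by (simp add: c_def)
  from sum_multiplicities_ge[OF this \<open>m \<ge> 2\<close>]
  have "int ((p - 1) * q ^ (m - 1) + p * q ^ (m - 2)) \<le> int (\<Sum>x\<in>UNIV. c x)"
    unfolding assms(6) of_nat_le_iff .
  moreover have "int (\<Sum>x\<in>UNIV. c x) = coord_sum s" by (simp add: coord_sum_def int_c)
  moreover have "int (p - 1) = int p - 1" using assms(5) by (simp add: of_nat_diff)
  ultimately show ?thesis by (simp only: of_nat_add of_nat_mult of_nat_power)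
qed

end
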